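(* Let $k\ge 4$ be an even integer and let $H$ be a graph on $2k-1$ vertices in which every vertex has degree $k-1$ except exactly one vertex, which has degree $k-2$. Then the number of triangles in $H$ satisfies $$\mathcal{N}(K_3,H)\le 2\binom{k-1}{3}+\left(\frac{k}{2}-1\right)^2,$$ with equality if and only if $H$ is isomorphic to $H_k$.
   Context: $\mathcal{N}(K_3,H)$ denotes the number of triangles in $H$. For even $k\ge 4$, the graph $H_k$ is defined as follows: let $X=\{x_1,\dots,x_{k-1}\}$, $Y=\{y_1,\dots,y_{k-1}\}$; start from the complete bipartite graph with parts $X$ and $Y$, subdivide each edge $x_iy_i$ with $i\le \frac{k}{2}-1$ once, and identify the $\frac{k}{2}-1$ inserted subdivision vertices into a single vertex $z$; call the resulting graph $H_k'$. Then $H_k$ is the complement of $H_k'$ with the edge $zy_{k/2}$ deleted. *)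

theory Defs
  imports Graph_Theory.Graph_Theory
begin

text \<open>
  Finite simple graphs are the \<^locale>\<open>pair_graph\<close>s: finite, loop-free digraphs with a
  symmetric arc relation, an edge \<open>uv\<close> being the two arcs \<open>(u,v)\<close> and \<open>(v,u)\<close>. In such a graph
  \<^const>\<open>out_degree\<close> is the usual degree and \<^const>\<open>digraph_iso\<close> is the usual isomorphism.
\<close>

definition triangles :: "'a pair_pre_digraph \<Rightarrow> 'a set set" where
  "triangles G = {T. T \<subseteq> pverts G \<and> card T = 3 \<and>
     (\<forall>u \<in> T. \<forall>v \<in> T. u \<noteq> v \<longrightarrow> (u, v) \<in> parcs G)}"

definition num_triangles :: "'a pair_pre_digraph \<Rightarrow> nat" where
  "num_triangles G = card (triangles G)"

definition complement_graph :: "'a pair_pre_digraph \<Rightarrow> 'a pair_pre_digraph" where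
  "complement_graph G = \<lparr> pverts = pverts G,
     parcs = {(u, v). u \<in> pverts G \<and> v \<in> pverts G \<and> u \<noteq> v \<and> (u, v) \<notin> parcs G} \<rparr>"

definition delete_edge :: "'a pair_pre_digraph \<Rightarrow> 'a \<Rightarrow> 'a \<Rightarrow> 'a pair_pre_digraph" where
  "delete_edge G u v = \<lparr> pverts = pverts G, parcs = parcs G - {(u, v), (v, u)} \<rparr>"

definition complete_bipartite :: "'a set \<Rightarrow> 'a set \<Rightarrow> 'a pair_pre_digraph" where
  "complete_bipartite A B = \<lparr> pverts = A \<union> B, parcs = A \<times> B \<union> B \<times> A \<rparr>"

definition identify_verts :: "'a set \<Rightarrow> 'a \<Rightarrow> 'a pair_pre_digraph \<Rightarrow> 'a pair_pre_digraph" where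
  "identify_verts W z G = (let f = (\<lambda>v. if v \<in> W then z else v) in
     \<lparr> pverts = f ` pverts G, parcs = map_prod f f ` parcs G \<rparr>)"

text \<open>
  \<open>Xv i\<close>, \<open>Yv i\<close> and \<open>Zv\<close> are \<open>x\<^sub>i\<close>, \<open>y\<^sub>i\<close> and \<open>z\<close>; \<open>Sv i\<close> is the vertex subdividing the edge
  \<open>x\<^sub>i y\<^sub>i\<close>, which occurs only before the identification.
\<close>

datatype hk_vertex = Xv nat | Yv nat | Sv nat | Zv

definition subdivided_bipartite :: "nat \<Rightarrow> hk_vertex pair_pre_digraph" where
  "subdivided_bipartite k =
     fold (\<lambda>i G. subdivide G (Xv i, Yv i) (Sv i)) [1..<k div 2]
       (complete_bipartite (Xv ` {1..k - 1}) (Yv ` {1..k - 1}))"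

definition Hk' :: "nat \<Rightarrow> hk_vertex pair_pre_digraph" where
  "Hk' k = identify_verts (Sv ` {1..k div 2 - 1}) Zv (subdivided_bipartite k)"

text \<open>The deleted edge \<open>z y\<^bsub>k/2\<^esub>\<close> is an edge of the complement, not of \<^term>\<open>Hk' k\<close>.\<close>

definition Hk :: "nat \<Rightarrow> hk_vertex pair_pre_digraph" where
  "Hk k = delete_edge (complement_graph (Hk' k)) Zv (Yv (k div 2))"

end

theory Submission
  imports Defs
begin

text \<open>
  Put \<open>r = k - 1 = 2m + 1\<close> and let \<open>G\<close> be the complement of \<open>H\<close>: it has \<open>2r + 1\<close> vertices, all of
  degree \<open>r\<close> except one vertex \<open>w\<close> of degree \<open>r + 1\<close>. By Goodman's identity the triangle counts of
  \<open>G\<close> and \<open>H\<close> have a constant sum, and the claim becomes \<open>t(G) \<ge> m\<^sup>2\<close>.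

  Cut the vertices into \<open>A\<close> and \<open>B\<close> with \<open>|A| = r + 1\<close>, \<open>|B| = r\<close>. An edge \<open>xy\<close> inside \<open>A\<close> has at least
  \<open>d\<^sub>B(x) + d\<^sub>B(y) - |B|\<close> common neighbours in \<open>B\<close>, and likewise for \<open>B\<close>. Summing, and using
  \<open>\<Sum> d\<^sub>A(x)\<^sup>2 \<le> p (p + 1)\<close> for the number \<open>p\<close> of edges inside \<open>A\<close>, bounds \<open>t(G)\<close> in terms of \<open>p\<close> and the
  number \<open>q\<close> of edges inside \<open>B\<close>, where the degrees force \<open>p = q + m\<close> if \<open>w \<in> B\<close> and \<open>p = q + m + 1\<close>
  otherwise. If \<open>w \<in> B\<close> and \<open>q < m\<close>, the bound is \<open>m\<^sup>2 + q (2m - 1 - 2q) \<ge> m\<^sup>2\<close>. Such a cut is obtained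
  from a neighbourhood: \<open>A = N(w)\<close> works if \<open>w\<close> lies in fewer than \<open>2m\<close> triangles, and otherwise \<open>B = N(v)\<close>
  for the vertex \<open>v \<noteq> w\<close> in the fewest triangles works, or else \<open>t(G) > m\<^sup>2\<close>.

  In the case of equality \<open>B\<close> is independent and \<open>A\<close> carries a star with \<open>m\<close> leaves, whose centre
  is the vertex \<open>z\<close> of \<open>H\<^sub>k\<close>; the vertex \<open>w\<close> is \<open>y\<^bsub>k/2\<^esub>\<close>.
\<close>

section \<open>Counting in a symmetric relation\<close>

text \<open>All sums run over ordered tuples: \<open>vol S\<close> is twice the number of edges inside \<open>S\<close> and \<open>tri S\<close>
  is six times the number of triangles inside \<open>S\<close>.\<close>

locale sym_rel =
  fixes adj :: "'a \<Rightarrow> 'a \<Rightarrow> bool"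
  assumes adj_sym: "adj x y \<Longrightarrow> adj y x"
    and adj_irrefl: "\<not> adj x x"
begin

definition e :: "'a \<Rightarrow> 'a \<Rightarrow> int" where
  "e x y = of_bool (adj x y)"

definition dg :: "'a set \<Rightarrow> 'a \<Rightarrow> int" where
  "dg S x = (\<Sum>y\<in>S. e x y)"

definition vol :: "'a set \<Rightarrow> int" where
  "vol S = (\<Sum>x\<in>S. dg S x)"

definition sq :: "'a set \<Rightarrow> int" where
  "sq S = (\<Sum>x\<in>S. (dg S x)\<^sup>2)"

definition tri :: "'a set \<Rightarrow> int" where
  "tri S = (\<Sum>x\<in>S. \<Sum>y\<in>S. \<Sum>z\<in>S. e x y * e x z * e y z)"

text \<open>For disjoint \<open>A\<close> and \<open>B\<close> this is twice the number of triangles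
  with two vertices in \<open>A\<close> and one in \<open>B\<close>.\<close>

definition cross :: "'a set \<Rightarrow> 'a set \<Rightarrow> int" where
  "cross A B = (\<Sum>x\<in>A. \<Sum>y\<in>A. \<Sum>z\<in>B. e x y * e x z * e y z)"

lemma e_sym: "e x y = e y x"
  using adj_sym by (auto simp: e_def)

lemma e_irrefl [simp]: "e x x = 0"
  by (simp add: e_def adj_irrefl)

lemma e_bounds [simp]: "0 \<le> e x y" "e x y \<le> 1"
  by (auto simp: e_def)

lemma dg_nonneg [simp]: "0 \<le> dg S x"
  by (simp add: dg_def sum_nonneg)

lemma vol_nonneg [simp]: "0 \<le> vol S"
  by (simp add: vol_def sum_nonneg)

lemma tri_nonneg [simp]: "0 \<le> tri S"
  by (simp add: tri_def sum_nonneg)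

lemma dg_card: "finite S \<Longrightarrow> dg S x = int (card {y \<in> S. adj x y})"
  by (simp add: dg_def e_def Int_def)

lemma dg_Un: "finite A \<Longrightarrow> finite B \<Longrightarrow> A \<inter> B = {} \<Longrightarrow> dg (A \<union> B) x = dg A x + dg B x"
  by (simp add: dg_def sum.union_disjoint)

lemma sum_dg_swap: "(\<Sum>x\<in>A. dg B x) = (\<Sum>x\<in>B. dg A x)"
  unfolding dg_def by (subst sum.swap) (simp add: e_sym)

text \<open>Inserting a vertex adds its degree twice. Parity later excludes the odd values of
  \<open>vol B\<close> at which the slack of a cut would vanish.\<close>

lemma even_vol: "finite S \<Longrightarrow> even (vol S)"
proof (induction S rule: finite_induct)
  case empty
  then show ?case by (simp add: vol_def)
next
  case (insert a S)
  have "vol (insert a S) = dg (insert a S) a + (\<Sum>x\<in>S. e x a + dg S x)"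
    using insert by (simp add: vol_def dg_def)
  also have "\<dots> = dg S a + (\<Sum>x\<in>S. e a x) + vol S"
    using insert by (simp add: vol_def dg_def sum.distrib e_sym)
  also have "\<dots> = 2 * dg S a + vol S"
    by (simp add: dg_def)
  finally show ?case using insert by simp
qed

section \<open>Degree squares and disjoint edges\<close>

text \<open>The edges avoiding \<open>x\<close> and \<open>y\<close> are all edges minus those at
  \<open>x\<close> or at \<open>y\<close>, where \<open>x y\<close> itself is counted in both
  degrees; everything is doubled.\<close>

lemma vol_edge:
  assumes "finite S" "x \<in> S" "y \<in> S" "adj x y"
  shows "vol S + 2 - 2 * (dg S x + dg S y) = vol (S - {x, y})"
proof -
  let ?R = "S - {x, y}"
  have xy: "x \<noteq> y" using assms adj_irrefl by auto
  have S: "S = insert x (insert y ?R)" using assms by auto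
  have e1: "e x y = 1" "e y x = 1" using assms adj_sym by (auto simp: e_def)
  have fin: "finite ?R" using assms by simp
  have d: "dg S u = e u x + e u y + dg ?R u" for u
    using xy fin by (subst S, simp add: dg_def)
  have "vol S = dg S x + dg S y + (\<Sum>u\<in>?R. dg S u)"
    unfolding vol_def using xy fin by (subst (1) S, simp)
  also have "(\<Sum>u\<in>?R. dg S u) = dg ?R x + dg ?R y + vol ?R"
    by (simp add: d sum.distrib vol_def) (simp add: dg_def e_sym)
  finally show ?thesis
    using d[of x] d[of y] e1 by simp
qed

lemma sq_eq: "2 * sq S = (\<Sum>x\<in>S. \<Sum>y\<in>S. e x y * (dg S x + dg S y))"
proof -
  have 1: "(\<Sum>x\<in>S. \<Sum>y\<in>S. e x y * dg S x) = sq S"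
    by (simp add: sq_def power2_eq_square flip: sum_distrib_right) (simp add: dg_def)
  have 2: "(\<Sum>x\<in>S. \<Sum>y\<in>S. e x y * dg S y) = sq S"
    by (subst sum.swap) (simp add: 1 e_sym)
  show ?thesis by (simp add: distrib_left sum.distrib 1 2)
qed

text \<open>The right-hand side counts pairs of arcs without a common end. It is nonnegative, which
  gives \<open>sq_le\<close>, and it vanishes only if every two edges meet.\<close>

lemma sq_gap:
  assumes "finite S"
  shows "vol S * (vol S + 2) - 4 * sq S = (\<Sum>x\<in>S. \<Sum>y\<in>S. e x y * vol (S - {x, y}))"
proof -
  have "(\<Sum>x\<in>S. \<Sum>y\<in>S. e x y * vol (S - {x, y})) =
      (\<Sum>x\<in>S. \<Sum>y\<in>S. e x y * (vol S + 2) - 2 * (e x y * (dg S x + dg S y)))"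
  proof (intro sum.cong refl)
    fix x y assume xy: "x \<in> S" "y \<in> S"
    show "e x y * vol (S - {x, y}) = e x y * (vol S + 2) - 2 * (e x y * (dg S x + dg S y))"
    proof (cases "adj x y")
      case True
      from vol_edge[OF assms xy True] show ?thesis by (simp add: algebra_simps)
    qed (simp add: e_def)
  qed
  also have "\<dots> = vol S * (vol S + 2) - 2 * (2 * sq S)"
    unfolding sq_eq by (simp add: sum_subtractf vol_def sum_distrib_left sum_distrib_right dg_def)
  finally show ?thesis by simp
qed

lemma sq_le:
  assumes "finite S"
  shows "4 * sq S \<le> vol S * (vol S + 2)"
proof -
  have "0 \<le> (\<Sum>x\<in>S. \<Sum>y\<in>S. e x y * vol (S - {x, y}))"
    by (intro sum_nonneg mult_nonneg_nonneg) auto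
  then show ?thesis using sq_gap[OF assms] by simp
qed

text \<open>Equality makes every summand in \<open>sq_gap\<close> vanish, so no edge avoids the edge
  \<open>x y\<close>, and \<open>vol_edge\<close> then fixes the degree sum.\<close>

lemma sq_eqD:
  assumes "finite S" "4 * sq S = vol S * (vol S + 2)" "x \<in> S" "y \<in> S" "adj x y"
  shows "vol (S - {x, y}) = 0" "2 * (dg S x + dg S y) = vol S + 2"
proof -
  have 0: "(\<Sum>x\<in>S. \<Sum>y\<in>S. e x y * vol (S - {x, y})) = 0"
    using sq_gap[OF assms(1)] assms(2) by simp
  have "\<forall>x\<in>S. (\<Sum>y\<in>S. e x y * vol (S - {x, y})) = 0"
    using 0 assms(1) by (subst (asm) sum_nonneg_eq_0_iff) (auto intro!: sum_nonneg)
  then have "\<forall>y\<in>S. e x y * vol (S - {x, y}) = 0"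
    using assms(1,3) by (subst (asm) sum_nonneg_eq_0_iff) auto
  then show "vol (S - {x, y}) = 0" using assms(4,5) by (auto simp: e_def)
  then show "2 * (dg S x + dg S y) = vol S + 2"
    using vol_edge[OF assms(1,3-5)] by simp
qed

section \<open>Triangles across a cut\<close>

lemma cross_swap:
  "(\<Sum>x\<in>A. \<Sum>y\<in>B. \<Sum>z\<in>A. e x y * e x z * e y z) = cross A B"
  "(\<Sum>x\<in>B. \<Sum>y\<in>A. \<Sum>z\<in>A. e x y * e x z * e y z) = cross A B"
proof -
  show "(\<Sum>x\<in>A. \<Sum>y\<in>B. \<Sum>z\<in>A. e x y * e x z * e y z) = cross A B"
    unfolding cross_def
    by (rule sum.cong[OF refl], subst sum.swap) (simp add: e_sym mult_ac)
  then show "(\<Sum>x\<in>B. \<Sum>y\<in>A. \<Sum>z\<in>A. e x y * e x z * e y z) = cross A B"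
    by (subst sum.swap) (simp add: e_sym mult_ac)
qed

text \<open>The factor 3 counts the positions of the vertex that is alone on its side; by
  \<open>cross_swap\<close> the position does not matter.\<close>

lemma tri_Un:
  assumes "finite A" "finite B" "A \<inter> B = {}"
  shows "tri (A \<union> B) = tri A + tri B + 3 * cross A B + 3 * cross B A"
proof -
  have "tri (A \<union> B) =
      tri A + cross A B + (\<Sum>x\<in>A. \<Sum>y\<in>B. \<Sum>z\<in>A. e x y * e x z * e y z)
    + (\<Sum>x\<in>A. \<Sum>y\<in>B. \<Sum>z\<in>B. e x y * e x z * e y z)
    + (\<Sum>x\<in>B. \<Sum>y\<in>A. \<Sum>z\<in>A. e x y * e x z * e y z)
    + (\<Sum>x\<in>B. \<Sum>y\<in>A. \<Sum>z\<in>B. e x y * e x z * e y z)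
    + cross B A + tri B"
    using assms by (simp add: tri_def cross_def sum.union_disjoint sum.distrib)
  then show ?thesis by (simp add: cross_swap)
qed

text \<open>Two vertices have at least \<open>dg B x + dg B y - card B\<close> common neighbours in
  \<open>B\<close>; pointwise this is \<open>a * b \<ge> a + b - 1\<close> for \<open>a\<close> and
  \<open>b\<close> in {0, 1}.\<close>

lemma cross_ge:
  assumes "finite A" "finite B"
  shows "cross A B \<ge> 2 * (\<Sum>x\<in>A. dg A x * dg B x) - int (card B) * vol A"
proof -
  have "(\<Sum>x\<in>A. \<Sum>y\<in>A. \<Sum>z\<in>B. e x y * (e x z + e y z - 1)) \<le> cross A B"
    unfolding cross_def by (intro sum_mono) (auto simp: e_def)
  moreover have "(\<Sum>x\<in>A. \<Sum>y\<in>A. \<Sum>z\<in>B. e x y * (e x z + e y z - 1)) =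
     (\<Sum>x\<in>A. \<Sum>y\<in>A. e x y * dg B x) + (\<Sum>x\<in>A. \<Sum>y\<in>A. e x y * dg B y) - int (card B) * vol A"
    by (simp add: dg_def vol_def algebra_simps sum.distrib sum_subtractf flip: sum_distrib_left)
  moreover have 1: "(\<Sum>x\<in>A. \<Sum>y\<in>A. e x y * dg B x) = (\<Sum>x\<in>A. dg A x * dg B x)"
    by (simp add: dg_def flip: sum_distrib_right)
  moreover have "(\<Sum>x\<in>A. \<Sum>y\<in>A. e x y * dg B y) = (\<Sum>x\<in>A. dg A x * dg B x)"
    by (subst sum.swap) (simp add: e_sym 1)
  ultimately show ?thesis by simp
qed

section \<open>Neighbourhoods\<close>

definition nbrs :: "'a set \<Rightarrow> 'a \<Rightarrow> 'a set" where
  "nbrs V v = {y \<in> V. adj v y}"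

lemma sum_nbrs: "finite V \<Longrightarrow> (\<Sum>y\<in>nbrs V v. f y) = (\<Sum>y\<in>V. e v y * f y)" for f :: "'a \<Rightarrow> int"
  unfolding nbrs_def by (rule sum.mono_neutral_cong_left) (auto simp: e_def)

text \<open>Edges inside the neighbourhood of \<open>v\<close> correspond to triangles through
  \<open>v\<close>.\<close>

lemma sum_vol_nbrs:
  assumes "finite V"
  shows "(\<Sum>v\<in>V. vol (nbrs V v)) = tri V"
  using assms by (simp add: vol_def dg_def tri_def sum_nbrs sum_distrib_left mult_ac)

end

section \<open>Cuts of a nearly regular graph\<close>

text \<open>With \<open>k = 2 * m + 2\<close> this is the complement of a graph as in the theorem:
  there are \<open>2 * k - 1\<close> vertices, all of degree \<open>k - 1\<close> except
  \<open>w\<close>, which has degree \<open>k\<close>.\<close>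

locale near_regular = sym_rel adj for adj :: "'a \<Rightarrow> 'a \<Rightarrow> bool" +
  fixes V :: "'a set" and w :: 'a and m :: nat
  assumes finV: "finite V"
    and cardV: "card V = 4 * m + 3"
    and wV: "w \<in> V"
    and dg_w: "dg V w = 2 * int m + 2"
    and dg_V: "v \<in> V \<Longrightarrow> v \<noteq> w \<Longrightarrow> dg V v = 2 * int m + 1"
    and m_pos: "m \<ge> 1"
begin

lemma dg_V_eq: "v \<in> V \<Longrightarrow> dg V v = 2 * int m + 1 + of_bool (v = w)"
  using dg_w dg_V by auto

lemma dg_compl:
  assumes "A \<union> B = V" "A \<inter> B = {}" "v \<in> V"
  shows "dg B v = 2 * int m + 1 + of_bool (v = w) - dg A v"
  using dg_V_eq[OF assms(3)] dg_Un[of A B v] assms finV by (metis add_diff_cancel_left' finite_Un)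

lemma sum_of_bool_w: "finite S \<Longrightarrow> (\<Sum>x\<in>S. of_bool (x = w) * f x) = (if w \<in> S then f w else (0::int))"
  by (simp add: of_bool_def if_distrib[of "\<lambda>c. c * _"] cong: if_cong)

lemma sum_dg_compl:
  assumes "A \<union> B = V" "A \<inter> B = {}"
  shows "(\<Sum>x\<in>A. dg B x) = (2 * int m + 1) * int (card A) + of_bool (w \<in> A) - vol A"
proof -
  have fin: "finite A" using assms finV by auto
  have "(\<Sum>x\<in>A. dg B x) = (\<Sum>x\<in>A. 2 * int m + 1 + of_bool (x = w) - dg A x)"
    using dg_compl[OF assms] assms(1) by (intro sum.cong) auto
  then show ?thesis
    using fin sum_of_bool_w[OF fin, of "\<lambda>_. 1"]
    by (simp add: vol_def sum.distrib sum_subtractf algebra_simps)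
qed

text \<open>This evaluates the main term of \<open>cross_ge\<close>; the last summand is due to the
  extra edge at \<open>w\<close>.\<close>

lemma sum_dg_mult_compl:
  assumes "A \<union> B = V" "A \<inter> B = {}"
  shows "(\<Sum>x\<in>A. dg A x * dg B x) = (2 * int m + 1) * vol A - sq A + of_bool (w \<in> A) * dg A w"
proof -
  have fin: "finite A" using assms finV by auto
  have "(\<Sum>x\<in>A. dg A x * dg B x) =
      (\<Sum>x\<in>A. (2 * int m + 1) * dg A x + of_bool (x = w) * dg A x - (dg A x)\<^sup>2)"
  proof (rule sum.cong[OF refl])
    fix x assume "x \<in> A"
    then have x: "dg B x = 2 * int m + 1 + of_bool (x = w) - dg A x"
      using dg_compl[OF assms] assms(1) by auto
    have "a * (n + b - a) = n * a + b * a - a\<^sup>2" for a b n :: int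
      by (simp add: algebra_simps power2_eq_square)
    then show "dg A x * dg B x = (2 * int m + 1) * dg A x + of_bool (x = w) * dg A x - (dg A x)\<^sup>2"
      unfolding x .
  qed
  then show ?thesis
    using sum_of_bool_w[OF fin, of "dg A"]
    by (simp add: vol_def sq_def sum.distrib sum_subtractf sum_distrib_left)
qed

text \<open>\<open>cross_ge\<close> is applied to both sides. The coefficients
  \<open>2 * int m + 1\<close> and \<open>2 * int m\<close> differ because \<open>card A\<close> is
  one more than \<open>card B\<close>. The second claim counts the edges across the cut from both
  sides.\<close>

lemma cut_bound:
  assumes "A \<union> B = V" "A \<inter> B = {}" "card A = 2 * m + 2" "card B = 2 * m + 1"
  shows "tri V \<ge> tri A + tri B + 3 * ((2 * int m + 1) * vol A - 2 * sq A
     + 2 * int m * vol B - 2 * sq B + 2 * (if w \<in> A then dg A w else dg B w))"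
    and "vol A = vol B + 2 * int m + 2 * of_bool (w \<in> A)"
proof -
  have fin: "finite A" "finite B" using assms finV by auto
  have BA: "B \<union> A = V" "B \<inter> A = {}" using assms by auto
  have wAB: "w \<in> B \<longleftrightarrow> w \<notin> A" using assms wV by auto
  note S = sum_dg_mult_compl[OF assms(1,2)] sum_dg_mult_compl[OF BA]
  have "tri V = tri A + tri B + 3 * cross A B + 3 * cross B A"
    using tri_Un[OF fin assms(2)] assms(1) by simp
  with cross_ge[OF fin] cross_ge[OF fin(2) fin(1)]
  show "tri V \<ge> tri A + tri B + 3 * ((2 * int m + 1) * vol A - 2 * sq A
     + 2 * int m * vol B - 2 * sq B + 2 * (if w \<in> A then dg A w else dg B w))"
    unfolding S assms(3,4) using wAB by (auto simp: algebra_simps)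
  show "vol A = vol B + 2 * int m + 2 * of_bool (w \<in> A)"
    using sum_dg_swap[of A B] unfolding sum_dg_compl[OF assms(1,2)] sum_dg_compl[OF BA] assms(3,4)
    using wAB by (auto simp: algebra_simps)
qed

lemma cut_bound_in:
  assumes cut: "A \<union> B = V" "A \<inter> B = {}" "card A = 2 * m + 2" "card B = 2 * m + 1"
    and w: "w \<in> B" and small: "vol B < 2 * int m"
  shows "tri V \<ge> 6 * (int m)\<^sup>2"
    and "tri V \<le> 6 * (int m)\<^sup>2 \<Longrightarrow> vol B = 0 \<and> tri A = 0 \<and> 4 * sq A = vol A * (vol A + 2)"
proof -
  have fin: "finite A" "finite B" using cut finV by auto
  have wA: "w \<notin> A" using cut w by auto
  let ?M = "int m" and ?Q = "vol B"
  have P: "vol A = ?Q + 2 * ?M"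
    using cut_bound(2)[OF cut] wA by simp
  have sB: "4 * sq B \<le> ?Q * (?Q + 2)" using sq_le[OF fin(2)] .
  have sA: "4 * sq A \<le> vol A * (vol A + 2)" using sq_le[OF fin(1)] .
  have b: "tri V \<ge> tri A + tri B + 3 * ((2 * ?M + 1) * vol A - 2 * sq A + 2 * ?M * ?Q - 2 * sq B + 2 * dg B w)"
    using cut_bound(1)[OF cut] wA by simp
  \<comment> \<open>\<open>s\<close> measures how far \<open>A\<close> is from equality in
    \<open>sq_le\<close>; \<open>g\<close> is the gain from the edges inside
    \<open>B\<close>.\<close>
  define s where "s = vol A * (vol A + 2) - 4 * sq A"
  define g where "g = ?Q * (2 * ?M - 1 - ?Q)"
  have gap: "2 * tri V \<ge> 12 * ?M\<^sup>2 + 6 * g + 2 * tri A + 3 * s"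
    using b sB tri_nonneg[of B] dg_nonneg[of B w] unfolding P s_def g_def
    by (simp add: algebra_simps power2_eq_square del: tri_nonneg dg_nonneg)
  \<comment> \<open>By parity \<open>vol B \<le> 2 * int m - 2\<close>, so the second factor of
    \<open>g\<close> is positive and \<open>g = 0\<close> forces \<open>vol B = 0\<close>.\<close>
  obtain q where q: "?Q = 2 * q" using even_vol[OF fin(2)] by (auto elim: evenE)
  have q0: "0 \<le> q" "q \<le> ?M - 1" using q small vol_nonneg[of B] by auto
  have nn: "0 \<le> g" unfolding g_def using q q0 by (intro mult_nonneg_nonneg) auto
  have s0: "0 \<le> s" using sA by (simp add: s_def)
  show "tri V \<ge> 6 * ?M\<^sup>2"
    using gap nn s0 tri_nonneg[of A] by linarith
  assume "tri V \<le> 6 * ?M\<^sup>2"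
  then have "g = 0" "tri A = 0" "s = 0"
    using gap nn s0 tri_nonneg[of A] by linarith+
  moreover have "2 * ?M - 1 - ?Q \<noteq> 0" using q q0 by simp
  ultimately show "vol B = 0 \<and> tri A = 0 \<and> 4 * sq A = vol A * (vol A + 2)"
    by (auto simp: g_def s_def)
qed

text \<open>If \<open>w \<in> A\<close>, the cut alone does not give the strict bound when \<open>B\<close> is independent and
  \<open>w\<close> has a single neighbour \<open>c\<close> in \<open>A\<close>; then \<open>w\<close> lies in \<open>dg B c\<close> triangles, and the
  assumption on \<open>w\<close> forces \<open>w c\<close> to be an isolated edge of \<open>A\<close>.\<close>

lemma cut_bound_out:
  assumes cut: "A \<union> B = V" "A \<inter> B = {}" "card A = 2 * m + 2" "card B = 2 * m + 1"
    and w: "w \<in> A" and big: "vol (nbrs V w) \<ge> 4 * int m"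
    and small: "(4 * int m + 2) * vol B \<le> 6 * (int m)\<^sup>2 - 4 * int m"
  shows "tri V > 6 * (int m)\<^sup>2"
proof -
  have fin: "finite A" "finite B" using cut finV by auto
  have wB: "w \<notin> B" using cut w by auto
  let ?M = "int m" and ?Q = "vol B"
  have P: "vol A = ?Q + 2 * ?M + 2"
    using cut_bound(2)[OF cut] w by simp
  have sB: "4 * sq B \<le> ?Q * (?Q + 2)" using sq_le[OF fin(2)] .
  have sA: "4 * sq A \<le> vol A * (vol A + 2)" using sq_le[OF fin(1)] .
  have b: "tri V \<ge> tri A + tri B + 3 * ((2 * ?M + 1) * vol A - 2 * sq A + 2 * ?M * ?Q - 2 * sq B + 2 * dg A w)"
    using cut_bound(1)[OF cut] w by simp
  define s where "s = vol A * (vol A + 2) - 4 * sq A"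
  define g where "g = ?Q * (2 * ?M - 3 - ?Q)"
  \<comment> \<open>Compared with a cut that has \<open>w\<close> in \<open>B\<close>, the constant
    drops by 12; the term \<open>12 * dg A w\<close> makes up for it once \<open>w\<close> has a
    neighbour in \<open>A\<close>.\<close>
  have gap: "2 * tri V \<ge> 12 * ?M\<^sup>2 - 12 + 6 * g + 12 * dg A w + 3 * s"
    using b sB tri_nonneg[of B] tri_nonneg[of A] unfolding P s_def g_def
    by (simp add: algebra_simps power2_eq_square del: tri_nonneg dg_nonneg)
  have s0: "0 \<le> s" using sA by (simp add: s_def)
  have dgB: "dg B w = 2 * ?M + 2 - dg A w"
    using dg_compl[OF cut(1,2) wV] by simp
  \<comment> \<open>\<open>w\<close> has \<open>2 * m + 2\<close> neighbours, one more than
    \<open>B\<close> can hold.\<close>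
  have "dg B w \<le> int (card B)"
    using sum_mono[of B "e w" "\<lambda>_. 1"] by (simp add: dg_def)
  then have dgA: "dg A w \<ge> 1" using dgB cut(4) by simp
  obtain q where q: "?Q = 2 * q" using even_vol[OF fin(2)] by (auto elim: evenE)
  have q0: "0 \<le> q" using q vol_nonneg[of B] by auto
  consider "q = 0" "dg A w \<ge> 2" | "q = 0" "dg A w = 1" | "q \<ge> 1" using q0 dgA by linarith
  then show ?thesis
  proof cases
    case 1
    then have "g = 0" using q by (simp add: g_def)
    then show ?thesis using gap s0 1 by simp
  next
    case 2
    have "card {y \<in> A. adj w y} = 1" using 2 dg_card[OF fin(1), of w] by simp
    then obtain c where c: "{y \<in> A. adj w y} = {c}" by (auto simp: card_1_singleton_iff)
    then have cA: "c \<in> A" "adj w c" by auto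
    have wc: "w \<noteq> c" using cA adj_irrefl by auto
    have "dg B w = int (card B)" using dgB 2 cut(4) by simp
    then have "card {y \<in> B. adj w y} = card B" using dg_card[OF fin(2), of w] by simp
    then have "{y \<in> B. adj w y} = B" using fin(2) by (intro card_subset_eq) auto
    then have N: "nbrs V w = insert c B" using c cut(1) unfolding nbrs_def by auto
    have cB: "c \<notin> B" using cA cut by auto
    \<comment> \<open>The neighbourhood of \<open>w\<close> is \<open>B\<close> with
      \<open>c\<close> added, and \<open>B\<close> is independent in this case, so all its edges are
      at \<open>c\<close>.\<close>
    have "vol (nbrs V w) = vol B + 2 * dg B c"
      unfolding N vol_def using fin cB by (simp add: dg_def sum.distrib e_sym)
    then have "dg B c \<ge> 2 * ?M" using big q 2 by simp
    moreover have "dg B c = 2 * ?M + 1 - dg A c"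
      using dg_compl[OF cut(1,2), of c] cA cut(1) wc by auto
    \<comment> \<open>Both \<open>w\<close> and \<open>c\<close> have degree at most 1 in
      \<open>A\<close>, too little for an edge in the equality case of \<open>sq_le\<close>.\<close>
    ultimately have "2 * (dg A w + dg A c) < vol A + 2" using 2 P q m_pos by simp
    then have "4 * sq A \<noteq> vol A * (vol A + 2)"
      using sq_eqD(2)[OF fin(1) _ w cA] by auto
    then have "s \<noteq> 0" by (simp add: s_def)
    moreover have "g = 0" using q 2 by (simp add: g_def)
    ultimately show ?thesis using gap s0 2 by simp
  next
    case 3
    have M: "?M \<ge> 1" using m_pos by simp
    \<comment> \<open>If \<open>q \<ge> m - 1\<close>, the averaging bound \<open>small\<close>
      leaves only \<open>m = 1\<close>, where it contradicts \<open>q \<ge> 1\<close>.\<close>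
    have "q \<le> ?M - 2"
    proof (rule ccontr)
      assume "\<not> q \<le> ?M - 2"
      then have "q \<ge> ?M - 1" by simp
      then have "(4 * ?M + 2) * (2 * (?M - 1)) \<le> (4 * ?M + 2) * ?Q"
        using q by (intro mult_left_mono) auto
      then have "2 * ?M\<^sup>2 \<le> 4" using small by (simp add: algebra_simps power2_eq_square)
      moreover have "?M \<ge> 2 \<Longrightarrow> ?M\<^sup>2 \<ge> 2\<^sup>2" by (intro power_mono) auto
      ultimately have "?M = 1" using M by fastforce
      then show False using small q 3 by simp
    qed
    then have "0 < g" unfolding g_def using q 3 by (intro mult_pos_pos) auto
    then show ?thesis using gap s0 dgA by linarith
  qed
qed

section \<open>Choice of the cut\<close>

lemma card_nbrs: "int (card (nbrs V v)) = dg V v"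
  using dg_card[OF finV, of v] by (simp add: nbrs_def)

text \<open>A larger \<open>tri V\<close> needs no cut; the assumption makes the average
  neighbourhood sparse.\<close>

lemma good_cut:
  assumes "tri V \<le> 6 * (int m)\<^sup>2"
  obtains A B where "A \<union> B = V" "A \<inter> B = {}" "card A = 2 * m + 2" "card B = 2 * m + 1"
    "w \<in> B" "vol B < 2 * int m"
proof -
  let ?M = "int m"
  have nV: "nbrs V v \<subseteq> V" for v by (auto simp: nbrs_def)
  show thesis
  proof (cases "vol (nbrs V w) < 4 * ?M")
    case True
    define A where "A = nbrs V w"
    define B where "B = V - A"
    have cut: "A \<union> B = V" "A \<inter> B = {}" using nV by (auto simp: A_def B_def)
    have cA: "card A = 2 * m + 2" using card_nbrs[of w] dg_w unfolding A_def by linarith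
    have cB: "card B = 2 * m + 1"
      using cA cardV finV nV[of w] unfolding B_def by (subst card_Diff_subset) (auto simp: A_def intro: finite_subset)
    have wB: "w \<in> B" using wV adj_irrefl by (auto simp: A_def B_def nbrs_def)
    have "w \<notin> A" using wB cut by auto
    \<comment> \<open>Here \<open>vol B = vol A - 2 * int m\<close>, and
      \<open>vol A < 4 * int m\<close> by the case assumption.\<close>
    then have "vol B < 2 * ?M"
      using cut_bound(2)[OF cut cA cB] True by (simp add: A_def)
    then show thesis using that[OF cut cA cB wB] by blast
  next
    case False
    have fin: "finite (V - {w})" and cVw: "card (V - {w}) = 4 * m + 2"
      using cardV wV finV by auto
    then have ne: "V - {w} \<noteq> {}" by fastforce
    \<comment> \<open>Among the \<open>4 * m + 2\<close> vertices other than \<open>w\<close>, one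
      whose neighbourhood spans the fewest edges, hence at most the average.\<close>
    obtain v where v: "v \<in> V" "v \<noteq> w" and mn: "\<And>u. u \<in> V - {w} \<Longrightarrow> vol (nbrs V v) \<le> vol (nbrs V u)"
      using arg_min_if_finite(1)[OF fin ne, of "\<lambda>u. vol (nbrs V u)"]
        arg_min_least[OF fin ne, of _ "\<lambda>u. vol (nbrs V u)"] by blast
    define B where "B = nbrs V v"
    define A where "A = V - B"
    have cut: "A \<union> B = V" "A \<inter> B = {}" using nV by (auto simp: A_def B_def)
    have cB: "card B = 2 * m + 1" using card_nbrs[of v] dg_V[OF v] unfolding B_def by linarith
    have cA: "card A = 2 * m + 2"
      using cB cardV finV nV[of v] unfolding A_def by (subst card_Diff_subset) (auto simp: B_def intro: finite_subset)
    have "(4 * ?M + 2) * vol B = (\<Sum>u\<in>V - {w}. vol B)" using cVw by simp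
    also have "\<dots> \<le> (\<Sum>u\<in>V - {w}. vol (nbrs V u))" using mn by (intro sum_mono) (auto simp: B_def)
    also have "\<dots> = tri V - vol (nbrs V w)"
      using sum_vol_nbrs[OF finV] wV finV by (simp add: sum_diff1)
    finally have small: "(4 * ?M + 2) * vol B \<le> 6 * ?M\<^sup>2 - 4 * ?M" using assms False by simp
    have "w \<notin> A" using cut_bound_out[OF cut cA cB] small False assms by auto
    then have "w \<in> B" using cut wV by auto
    moreover have "vol B < 2 * ?M"
    proof (rule ccontr)
      assume "\<not> vol B < 2 * ?M"
      then have "(4 * ?M + 2) * (2 * ?M) \<le> (4 * ?M + 2) * vol B" by (intro mult_left_mono) auto
      then have "2 * ?M\<^sup>2 + 8 * ?M \<le> 0" using small by (simp add: algebra_simps power2_eq_square)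
      moreover have "0 \<le> ?M\<^sup>2" by simp
      ultimately show False using m_pos by linarith
    qed
    ultimately show thesis using that[OF cut cA cB] by auto
  qed
qed

lemma tri_ge: "tri V \<ge> 6 * (int m)\<^sup>2"
proof (cases "tri V \<le> 6 * (int m)\<^sup>2")
  case True
  then show ?thesis using good_cut cut_bound_in(1) by metis
qed simp

end

section \<open>The extremal structure\<close>

lemma bij_betw_interval:
  assumes "finite S" "card S = b + 1 - a" "a \<le> b + 1"
  obtains f :: "nat \<Rightarrow> 'b" where "bij_betw f {a..b} S"
  using assms finite_same_card_bij[of "{a..b}" S] by auto

context sym_rel begin

lemma vol_0D:
  assumes "finite S" "vol S = 0" "x \<in> S" "y \<in> S"
  shows "\<not> adj x y"
proof -
  have "dg S x = 0"
    using assms by (simp add: vol_def sum_nonneg_eq_0_iff)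
  then have "e x y = 0"
    using assms by (simp add: dg_def sum_nonneg_eq_0_iff)
  then show ?thesis by (simp add: e_def)
qed

lemma tri_0D:
  assumes "finite S" "tri S = 0" "x \<in> S" "y \<in> S" "z \<in> S" "adj x y" "adj x z"
  shows "\<not> adj y z"
proof -
  have "(\<Sum>y\<in>S. \<Sum>z\<in>S. e x y * e x z * e y z) = 0"
    using assms(1-3) unfolding tri_def
    by (subst (asm) sum_nonneg_eq_0_iff) (auto intro!: sum_nonneg)
  then have "(\<Sum>z\<in>S. e x y * e x z * e y z) = 0"
    using assms(1,4) by (subst (asm) sum_nonneg_eq_0_iff) (auto intro!: sum_nonneg)
  then have "e x y * e x z * e y z = 0"
    using assms(1,5) by (subst (asm) sum_nonneg_eq_0_iff) auto
  then show ?thesis using assms(6,7) by (auto simp: e_def)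
qed

text \<open>Degrees close to \<open>card S\<close> are exploited through the few non-neighbours;
  \<open>x\<close> is its own non-neighbour if it lies in \<open>S\<close>.\<close>

lemma card_non_nbrs:
  assumes "finite S"
  shows "int (card {y \<in> S. \<not> adj x y}) = int (card S) - dg S x"
proof -
  have "card S = card {y \<in> S. adj x y} + card {y \<in> S. \<not> adj x y}"
    using assms by (subst card_Un_disjoint[symmetric]) (auto intro: arg_cong[where f=card])
  then show ?thesis using dg_card[OF assms] by simp
qed

lemma dg_pos_iff: "finite S \<Longrightarrow> dg S x > 0 \<longleftrightarrow> (\<exists>y\<in>S. adj x y)"
  by (auto simp: dg_card card_gt_0_iff)

lemma other_nbr:
  assumes "finite S" "dg S x \<ge> 2"
  obtains y where "y \<in> S" "adj x y" "y \<noteq> z"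
proof -
  have "card {y \<in> S. adj x y} \<ge> 2" using assms dg_card[of S x] by simp
  then have "\<not> {y \<in> S. adj x y} \<subseteq> {z}" using card_mono[of "{z}" "{y \<in> S. adj x y}"] by auto
  then show thesis using that by auto
qed

text \<open>Equality in \<open>sq_le\<close> says that all edges meet, so a triangle-free \<open>S\<close> carries a star.\<close>

lemma star:
  assumes fin: "finite S" and vol: "vol S = 2 * int m" and m: "m \<ge> 1"
    and sq: "4 * sq S = vol S * (vol S + 2)" and tri: "tri S = 0"
  obtains c where "c \<in> S" "dg S c = int m" "\<And>x. x \<in> S \<Longrightarrow> adj c x \<Longrightarrow> dg S x = 1"
    "\<And>x. x \<in> S \<Longrightarrow> x \<noteq> c \<Longrightarrow> \<not> adj c x \<Longrightarrow> dg S x = 0"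
proof -
  have edge: "dg S x + dg S y = int m + 1" if "x \<in> S" "y \<in> S" "adj x y" for x y
    using sq_eqD(2)[OF fin sq that] vol by simp
  have "\<exists>x\<in>S. dg S x \<noteq> 0" using vol m unfolding vol_def by (metis m int_eq_iff mult_eq_0_iff not_one_le_zero of_nat_0 sum.neutral zero_neq_numeral)
  then obtain x where x: "x \<in> S" "dg S x > 0" by (metis dg_nonneg order_le_less)
  then obtain y where y: "y \<in> S" "adj x y" using dg_pos_iff[OF fin] by auto
  have yx: "adj y x" using y adj_sym by auto
  have "dg S y > 0" using x yx dg_pos_iff[OF fin] by auto
  \<comment> \<open>If both ends had another neighbour, the absence of triangles would make these
    distinct, and the edges \<open>x x'\<close> and \<open>y y'\<close> would be disjoint.\<close>
  moreover have "\<not> (dg S x \<ge> 2 \<and> dg S y \<ge> 2)"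
  proof
    assume *: "dg S x \<ge> 2 \<and> dg S y \<ge> 2"
    obtain x' where x': "x' \<in> S" "adj x x'" "x' \<noteq> y" using other_nbr[OF fin, of x y] * by blast
    obtain y' where y': "y' \<in> S" "adj y y'" "y' \<noteq> x" using other_nbr[OF fin, of y x] * by blast
    have "x' \<noteq> y'" using tri_0D[OF fin tri x(1) y(1) x'(1) y(2) x'(2)] y' by auto
    then have "y \<in> S - {x, x'}" "y' \<in> S - {x, x'}" using x x' y y' adj_irrefl by auto
    then show False using vol_0D[of "S - {x, x'}" y y'] sq_eqD(1)[OF fin sq x(1) x'(1,2)] fin y' by auto
  qed
  ultimately have "dg S x = 1 \<or> dg S y = 1" using x by linarith
  \<comment> \<open>One end has degree 1, so by \<open>edge\<close> the other has degree
    \<open>m\<close>; it is the centre.\<close>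
  then obtain c where c: "c \<in> S" "dg S c = int m"
    using edge[OF x(1) y] x y by auto
  have nb: "dg S z = 1" if "z \<in> S" "adj c z" for z
    using edge[OF c(1) that] c by simp
  \<comment> \<open>The centre and its \<open>m\<close> leaves already contribute all of
    \<open>vol S\<close>, so every other degree is 0.\<close>
  let ?L = "{z \<in> S. adj c z}" and ?R = "{z \<in> S. z \<noteq> c \<and> \<not> adj c z}"
  have "S = insert c (?L \<union> ?R)" using c by auto
  then have "vol S = (\<Sum>z\<in>insert c (?L \<union> ?R). dg S z)" unfolding vol_def by (rule sum.cong) simp
  also have "\<dots> = dg S c + ((\<Sum>z\<in>?L. dg S z) + (\<Sum>z\<in>?R. dg S z))"
    using fin adj_irrefl by (subst sum.insert, simp, simp, subst sum.union_disjoint) auto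
  also have "(\<Sum>z\<in>?L. dg S z) = int m"
    using c nb dg_card[OF fin, of c] by simp
  finally have "(\<Sum>z\<in>?R. dg S z) = 0" using vol c by simp
  then have "\<forall>z\<in>?R. dg S z = 0" using fin by (subst (asm) sum_nonneg_eq_0_iff) auto
  then show thesis using that c nb by blast
qed

end

context near_regular begin

text \<open>\<open>B\<close> is independent and \<open>A\<close> carries a star with centre
  \<open>c\<close>. The degrees then only leave open a bijection between the \<open>m\<close> leaves
  and the neighbours of \<open>c\<close> in \<open>B\<close> other than \<open>w\<close>: each leaf
  misses its partner. The labels \<open>x i\<close> and \<open>y i\<close> follow this
  bijection.\<close>

lemma extremal_structure:
  assumes "tri V \<le> 6 * (int m)\<^sup>2"
  obtains x y :: "nat \<Rightarrow> 'a" and c :: 'a where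
    "inj_on x {1..2 * m + 1}" "inj_on y {1..2 * m + 1}"
    "V = insert c (x ` {1..2 * m + 1} \<union> y ` {1..2 * m + 1})"
    "c \<notin> x ` {1..2 * m + 1}" "c \<notin> y ` {1..2 * m + 1}"
    "x ` {1..2 * m + 1} \<inter> y ` {1..2 * m + 1} = {}"
    "\<And>i j. i \<in> {1..2 * m + 1} \<Longrightarrow> j \<in> {1..2 * m + 1} \<Longrightarrow> \<not> adj (x i) (x j)"
    "\<And>i j. i \<in> {1..2 * m + 1} \<Longrightarrow> j \<in> {1..2 * m + 1} \<Longrightarrow> \<not> adj (y i) (y j)"
    "\<And>i. i \<in> {1..2 * m + 1} \<Longrightarrow> adj c (x i) \<longleftrightarrow> i \<le> m"
    "\<And>i. i \<in> {1..2 * m + 1} \<Longrightarrow> adj c (y i) \<longleftrightarrow> i \<le> m + 1"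
    "\<And>i j. i \<in> {1..2 * m + 1} \<Longrightarrow> j \<in> {1..2 * m + 1} \<Longrightarrow> adj (x i) (y j) \<longleftrightarrow> \<not> (i = j \<and> i \<le> m)"
proof -
  obtain A B where cut: "A \<union> B = V" "A \<inter> B = {}" "card A = 2 * m + 2" "card B = 2 * m + 1"
    and wB: "w \<in> B" and small: "vol B < 2 * int m"
    using good_cut[OF assms] .
  have fin: "finite A" "finite B" using cut finV by auto
  have wA: "w \<notin> A" using cut wB by auto
  have eq: "vol B = 0" "tri A = 0" "4 * sq A = vol A * (vol A + 2)"
    using cut_bound_in(2)[OF cut wB small assms] by auto
  have volA: "vol A = 2 * int m" using cut_bound(2)[OF cut] wA eq by simp
  obtain c where c: "c \<in> A" "dg A c = int m" and leaf: "\<And>x. x \<in> A \<Longrightarrow> adj c x \<Longrightarrow> dg A x = 1"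
    and iso: "\<And>x. x \<in> A \<Longrightarrow> x \<noteq> c \<Longrightarrow> \<not> adj c x \<Longrightarrow> dg A x = 0"
    using star[OF fin(1) volA m_pos eq(3,2)] by metis
  have indepB: "\<not> adj u v" if "u \<in> B" "v \<in> B" for u v using vol_0D[OF fin(2) eq(1) that] .
  \<comment> \<open>\<open>L\<close> and \<open>R\<close> are the leaves and the isolated vertices
    of \<open>A\<close>; \<open>B2\<close> turns out to be the non-neighbours of \<open>c\<close> in
    \<open>B\<close>.\<close>
  define L where "L = {a \<in> A. adj c a}"
  define R where "R = A - L - {c}"
  define B1 where "B1 = {b \<in> B. adj c b} - {w}"
  define B2 where "B2 = B - B1 - {w}"
  have dgAB: "dg B a = 2 * int m + 1 - dg A a" if "a \<in> A" for a
    using dg_compl[OF cut(1,2), of a] that wA cut(1) by auto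
  have BA: "B \<union> A = V" "B \<inter> A = {}" using cut by auto
  \<comment> \<open>All neighbours of \<open>b\<close> lie in \<open>A\<close>, which has
    \<open>2 * m + 2\<close> vertices: \<open>w\<close> sees all of \<open>A\<close>, and every
    other \<open>b\<close> misses exactly one vertex.\<close>
  have dgBA: "dg A b = 2 * int m + 1 + of_bool (b = w)" if "b \<in> B" for b
  proof -
    have "dg B b = 0" using dg_pos_iff[OF fin(2), of b] indepB that dg_nonneg[of B b] by force
    then show ?thesis using dg_compl[OF BA, of b] that cut(1) by auto
  qed
  have w_adj: "adj a w" if "a \<in> A" for a
  proof -
    have "card {y \<in> A. \<not> adj w y} = 0" using card_non_nbrs[OF fin(1), of w] dgBA[OF wB] cut(3) by simp
    then show ?thesis using fin that adj_sym by auto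
  qed
  have one: "a = a'" if "b \<in> B" "a \<in> A" "a' \<in> A" "\<not> adj b a" "\<not> adj b a'" for a a' b
  proof -
    have "b \<noteq> w" using that w_adj adj_sym by blast
    then have "card {y \<in> A. \<not> adj b y} = 1"
      using card_non_nbrs[OF fin(1), of b] dgBA[OF that(1)] cut(3) by simp
    then obtain z where "{y \<in> A. \<not> adj b y} = {z}" by (auto simp: card_1_singleton_iff)
    then have "\<forall>y. y \<in> A \<and> \<not> adj b y \<longrightarrow> y = z" by auto
    then show ?thesis using that by metis
  qed
  have indepA: "\<not> adj a a'" if "a \<in> A" "a' \<in> A" "a \<noteq> c" "a' \<noteq> c" for a a'
  proof
    assume aa: "adj a a'"
    then have "dg A a > 0" "dg A a' > 0" using that adj_sym dg_pos_iff[OF fin(1)] by blast+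
    then have "adj c a" "adj c a'" using iso that by force+
    then show False using tri_0D[OF fin(1) eq(2) c(1) that(1,2)] aa by auto
  qed
  \<comment> \<open>A vertex isolated in \<open>A\<close> needs all \<open>2 * m + 1\<close>
    vertices of \<open>B\<close> to reach its degree.\<close>
  have R_adj: "adj a b" if "a \<in> R" "b \<in> B" for a b
  proof -
    have "dg A a = 0" using iso[of a] that by (auto simp: R_def L_def)
    then have "card {y \<in> B. \<not> adj a y} = 0"
      using card_non_nbrs[OF fin(2), of a] dgAB[of a] that cut(4) by (auto simp: R_def)
    then show ?thesis using fin that by auto
  qed
  \<comment> \<open>A leaf has one neighbour in \<open>A\<close>, hence misses one \<open>b\<close>
    in \<open>B\<close>. This \<open>b\<close> misses no other vertex of \<open>A\<close>, so it is
    adjacent to \<open>c\<close>.\<close>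
  have "\<exists>b\<in>B1. {y \<in> B. \<not> adj l y} = {b}" if "l \<in> L" for l
  proof -
    have lA: "l \<in> A" "adj c l" "l \<noteq> c" using that adj_irrefl by (auto simp: L_def)
    have "card {y \<in> B. \<not> adj l y} = 1"
      using card_non_nbrs[OF fin(2), of l] dgAB[of l] leaf lA cut(4) by simp
    then obtain b where b: "{y \<in> B. \<not> adj l y} = {b}" by (auto simp: card_1_singleton_iff)
    then have bB: "b \<in> B" "\<not> adj l b" by auto
    have "b \<noteq> w" using bB w_adj lA by auto
    moreover have "adj c b" using one[OF bB(1) lA(1) c(1)] bB lA adj_sym by blast
    ultimately show ?thesis using bB b by (auto simp: B1_def)
  qed
  then obtain \<nu> where \<nu>: "\<And>l. l \<in> L \<Longrightarrow> \<nu> l \<in> B1" "\<And>l. l \<in> L \<Longrightarrow> {y \<in> B. \<not> adj l y} = {\<nu> l}"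
    by metis
  have nadj: "adj l b \<longleftrightarrow> b \<noteq> \<nu> l" if "l \<in> L" "b \<in> B" for l b using \<nu>(2)[OF that(1)] that by auto
  have finL: "finite L" "finite R" "finite B1" "finite B2"
    using fin by (auto simp: L_def R_def B1_def B2_def)
  have cardL: "card L = m" using c dg_card[OF fin(1), of c] by (simp add: L_def)
  have "c \<notin> L" using adj_irrefl by (simp add: L_def)
  moreover have LA: "L \<subseteq> A" by (auto simp: L_def)
  ultimately have cardR: "card R = m + 1"
    using cut(3) cardL c finL unfolding R_def
    by (subst card_Diff_singleton) (auto simp: card_Diff_subset)
  \<comment> \<open>\<open>c\<close> has \<open>m\<close> neighbours in \<open>A\<close>, hence
    \<open>m + 1\<close> in \<open>B\<close>, one of which is \<open>w\<close>.\<close>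
  have "int (card {b \<in> B. adj c b}) = int m + 1" using dgAB[OF c(1)] c dg_card[OF fin(2), of c] by simp
  moreover have "w \<in> {b \<in> B. adj c b}" using w_adj c wB by auto
  ultimately have cardB1: "card B1 = m"
    using fin unfolding B1_def by (subst card_Diff_singleton) auto
  have B1B: "B1 \<subseteq> B" "w \<notin> B1" by (auto simp: B1_def)
  then have cardB2: "card B2 = m"
    using cut(4) cardB1 wB finL unfolding B2_def
    by (subst card_Diff_singleton) (auto simp: card_Diff_subset)
  have inj\<nu>: "inj_on \<nu> L"
  proof (rule inj_onI)
    fix l l' assume l: "l \<in> L" "l' \<in> L" "\<nu> l = \<nu> l'"
    have b: "\<nu> l \<in> B" using \<nu>(1)[OF l(1)] B1B by auto
    then have "\<not> adj l (\<nu> l)" "\<not> adj l' (\<nu> l)" using nadj l by auto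
    then show "l = l'" using one[OF b, of l l'] l LA adj_sym by blast
  qed
  then have bij\<nu>: "bij_betw \<nu> L B1"
    using \<nu>(1) cardL cardB1 finL by (intro bij_betw_imageI card_subset_eq) (auto simp: card_image)
  obtain x1 where x1: "bij_betw x1 {1..m} L" using bij_betw_interval[of L m 1] finL cardL by auto
  obtain x2 where x2: "bij_betw x2 {m + 1..2 * m + 1} R"
    using bij_betw_interval[of R "2 * m + 1" "m + 1"] finL cardR by auto
  obtain y2 where y2: "bij_betw y2 {m + 2..2 * m + 1} B2"
    using bij_betw_interval[of B2 "2 * m + 1" "m + 2"] finL cardB2 by auto
  define x where "x i = (if i \<le> m then x1 i else x2 i)" for i
  \<comment> \<open>For \<open>i \<le> m\<close> the vertex \<open>y i\<close> is the only
    non-neighbour of the leaf \<open>x i\<close> in \<open>B\<close>; the index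
    \<open>m + 1\<close>, that of the edge deleted in \<open>Hk\<close>, goes to
    \<open>w\<close>.\<close>
  define y where "y i = (if i \<le> m then \<nu> (x1 i) else if i = m + 1 then w else y2 i)" for i
  have I: "{1..2 * m + 1} = {1..m} \<union> {m + 1..2 * m + 1}"
    "{m + 1..2 * m + 1} = {m + 1} \<union> {m + 2..2 * m + 1}" by auto
  have bx1: "bij_betw x {1..m} L" using x1 by (subst bij_betw_cong[of _ _ x1]) (auto simp: x_def)
  have bx2: "bij_betw x {m + 1..2 * m + 1} R" using x2 by (subst bij_betw_cong[of _ _ x2]) (auto simp: x_def)
  have by1: "bij_betw y {1..m} B1"
    using bij_betw_trans[OF x1 bij\<nu>] by (subst bij_betw_cong[of _ _ "\<nu> \<circ> x1"]) (auto simp: y_def)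
  have by2: "bij_betw y {m + 2..2 * m + 1} B2" using y2 by (subst bij_betw_cong[of _ _ y2]) (auto simp: y_def)
  have by3: "bij_betw y {m + 1} {w}" by (simp add: bij_betw_def y_def)
  have bx: "bij_betw x {1..2 * m + 1} (L \<union> R)"
    unfolding I(1) by (rule bij_betw_combine[OF bx1 bx2]) (auto simp: R_def)
  have "bij_betw y {1..2 * m + 1} (B1 \<union> ({w} \<union> B2))"
    unfolding I by (rule bij_betw_combine[OF by1 bij_betw_combine[OF by3 by2]]) (auto simp: B1_def B2_def)
  moreover have "B1 \<union> ({w} \<union> B2) = B" using wB by (auto simp: B1_def B2_def)
  ultimately have by': "bij_betw y {1..2 * m + 1} B" by simp
  have LR: "L \<union> R = A - {c}" using \<open>c \<notin> L\<close> LA by (auto simp: R_def)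
  have xm: "x ` {1..2 * m + 1} = A - {c}" and ym: "y ` {1..2 * m + 1} = B"
    using bx by' LR by (auto simp: bij_betw_def)
  have xA: "x i \<in> A" "x i \<noteq> c" and yB: "y i \<in> B" if "i \<in> {1..2 * m + 1}" for i
    using xm ym that by blast+
  have xL: "x i \<in> L \<longleftrightarrow> i \<le> m" and xR: "i > m \<Longrightarrow> x i \<in> R" if "i \<in> {1..2 * m + 1}" for i
  proof -
    show *: "i > m \<Longrightarrow> x i \<in> R" using bij_betwE[OF bx2] that by auto
    show "x i \<in> L \<longleftrightarrow> i \<le> m"
      using * bij_betwE[OF bx1] that by (cases "i \<le> m") (auto simp: R_def)
  qed
  have cy: "adj c (y i) \<longleftrightarrow> i \<le> m + 1" if "i \<in> {1..2 * m + 1}" for i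
  proof -
    consider "i \<le> m" | "i = m + 1" | "i \<ge> m + 2" by linarith
    then show ?thesis
    proof cases
      case 1
      then have "y i \<in> B1" using bij_betwE[OF by1] that by auto
      then show ?thesis using 1 by (simp add: B1_def)
    next
      case 2
      then show ?thesis using w_adj c by (simp add: y_def)
    next
      case 3
      then have "y i \<in> B2" using bij_betwE[OF by2] that by auto
      then show ?thesis using 3 by (auto simp: B1_def B2_def)
    qed
  qed
  have xy: "adj (x i) (y j) \<longleftrightarrow> \<not> (i = j \<and> i \<le> m)"
    if i: "i \<in> {1..2 * m + 1}" and j: "j \<in> {1..2 * m + 1}" for i j
  proof (cases "i \<le> m")
    case True
    then have "y i = \<nu> (x i)" by (simp add: x_def y_def)
    moreover have "y j = y i \<longleftrightarrow> i = j" using by' i j by (auto simp: bij_betw_def inj_on_def)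
    ultimately show ?thesis using nadj[of "x i" "y j"] xL[OF i] yB[OF j] True by auto
  next
    case False
    then show ?thesis using R_adj xR[OF i] yB[OF j] by auto
  qed
  show thesis
  proof (rule that[of x y c])
    show "V = insert c (x ` {1..2 * m + 1} \<union> y ` {1..2 * m + 1})"
      unfolding xm ym using cut(1) c by auto
    show "adj c (x i) \<longleftrightarrow> i \<le> m" if "i \<in> {1..2 * m + 1}" for i
      using xL[OF that] xA[OF that] by (auto simp: L_def)
  qed (use bx by' xm ym c cut indepA indepB xA yB cy xy in \<open>auto simp: bij_betw_def\<close>)
qed

end

section \<open>Triangles of a graph and of its complement\<close>

context sym_rel begin

text \<open>Goodman's identity for ordered triples. \<open>co\<close> is adjacency in the
  complement, and \<open>dg V x * (int (card V) - 1 - dg V x)\<close> counts the pairs of an edge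
  and a non-edge at \<open>x\<close>.\<close>

lemma goodman:
  fixes co :: "'a \<Rightarrow> 'a \<Rightarrow> int"
  defines "co x y \<equiv> of_bool (x \<noteq> y \<and> \<not> adj x y)"
  assumes fin: "finite V"
  shows "tri V + (\<Sum>x\<in>V. \<Sum>y\<in>V. \<Sum>z\<in>V. co x y * co x z * co y z) =
    int (card V) * (int (card V) - 1) * (int (card V) - 2)
      - 3 * (\<Sum>x\<in>V. dg V x * (int (card V) - 1 - dg V x))"
proof -
  let ?n = "int (card V)"
  let ?D = "\<lambda>x y z. of_bool (x \<noteq> y \<and> x \<noteq> z \<and> y \<noteq> z) :: int"
  let ?S = "\<Sum>x\<in>V. dg V x * (?n - 1 - dg V x)"
  have ind: "(\<Sum>y\<in>V. of_bool (x \<noteq> y)) = ?n - 1" if "x \<in> V" for x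
  proof -
    have "V \<inter> {y. x \<noteq> y} = V - {x}" by auto
    moreover have "card V > 0" using that fin by (auto simp: card_gt_0_iff)
    ultimately show ?thesis using that fin by (simp add: of_nat_diff)
  qed
  have "(\<Sum>z\<in>V. ?D x y z) = of_bool (x \<noteq> y) * (?n - 2)" if "x \<in> V" "y \<in> V" for x y
  proof (cases "x = y")
    case False
    have "(\<Sum>z\<in>V. ?D x y z) = (\<Sum>z\<in>V. of_bool (x \<noteq> z) - of_bool (z = y))"
      using False by (intro sum.cong) auto
    also have "\<dots> = (?n - 1) - 1"
      using ind[OF that(1)] that(2) fin by (simp add: sum_subtractf of_bool_def del: sum_of_bool_eq)
    finally show ?thesis using False by simp
  qed simp
  then have D: "(\<Sum>x\<in>V. \<Sum>y\<in>V. \<Sum>z\<in>V. ?D x y z) = ?n * (?n - 1) * (?n - 2)"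
    using ind by (simp flip: sum_distrib_right)
  have codg: "(\<Sum>y\<in>V. co x y) = ?n - 1 - dg V x" if "x \<in> V" for x
  proof -
    have "(\<Sum>y\<in>V. co x y) = (\<Sum>y\<in>V. of_bool (x \<noteq> y) - e x y)"
      using adj_irrefl by (intro sum.cong) (auto simp: co_def e_def)
    then show ?thesis using ind[OF that] by (simp add: sum_subtractf dg_def)
  qed
  have m1: "(\<Sum>x\<in>V. \<Sum>y\<in>V. \<Sum>z\<in>V. e x y * co x z) = ?S"
    by (simp add: codg dg_def flip: sum_distrib_left sum_distrib_right)
  have m2: "(\<Sum>x\<in>V. \<Sum>y\<in>V. \<Sum>z\<in>V. e x z * co x y) = ?S"
    by (subst m1[symmetric]) (intro sum.cong[OF refl] sum.swap)
  define mix where "mix x y z = e x y * co x z + e x z * co x y" for x y z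
  define D where "D x y z = ?D x y z" for x y z :: 'a
  define eee where "eee x y z = e x y * e x z * e y z" for x y z
  define ccc where "ccc x y z = co x y * co x z * co y z" for x y z
  have M1: "(\<Sum>x\<in>V. \<Sum>y\<in>V. \<Sum>z\<in>V. mix x y z) = 2 * ?S"
    by (simp add: mix_def sum.distrib m1 m2)
  have M2: "(\<Sum>x\<in>V. \<Sum>y\<in>V. \<Sum>z\<in>V. mix y x z) = 2 * ?S"
    by (subst sum.swap) (rule M1)
  have "(\<Sum>x\<in>V. \<Sum>y\<in>V. \<Sum>z\<in>V. mix z x y) = (\<Sum>x\<in>V. \<Sum>z\<in>V. \<Sum>y\<in>V. mix z x y)"
    by (rule sum.cong[OF refl]) (rule sum.swap)
  with M2 have M3: "(\<Sum>x\<in>V. \<Sum>y\<in>V. \<Sum>z\<in>V. mix z x y) = 2 * ?S" by simp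
  \<comment> \<open>A triple that is neither a triangle nor independent is mixed at exactly two of its vertices.\<close>
  have "2 * eee x y z + 2 * ccc x y z + (mix x y z + mix y x z + mix z x y) = 2 * D x y z" for x y z
    unfolding eee_def ccc_def mix_def D_def
    using adj_sym[of x y] adj_sym[of y x] adj_sym[of x z] adj_sym[of z x] adj_sym[of y z] adj_sym[of z y]
      adj_irrefl[of x] adj_irrefl[of y]
    by (cases "x = y"; cases "x = z"; cases "y = z"; cases "adj x y"; cases "adj x z"; cases "adj y z")
      (auto simp: e_def co_def)
  then have "(\<Sum>x\<in>V. \<Sum>y\<in>V. \<Sum>z\<in>V. 2 * eee x y z + 2 * ccc x y z + (mix x y z + mix y x z + mix z x y))
      = (\<Sum>x\<in>V. \<Sum>y\<in>V. \<Sum>z\<in>V. 2 * D x y z)"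
    by simp
  then have "2 * tri V + 2 * (\<Sum>x\<in>V. \<Sum>y\<in>V. \<Sum>z\<in>V. ccc x y z) + 6 * ?S = 2 * (?n * (?n - 1) * (?n - 2))"
    by (simp add: sum.distrib M1 M2 M3 D[folded D_def] tri_def[folded eee_def] flip: sum_distrib_left)
  then show ?thesis by (simp add: ccc_def)
qed

end

section \<open>Ordered triples and triangles\<close>

lemma card_3_orderings:
  assumes "card T = 3"
  shows "card {(x, y, z). {x, y, z} = T} = 6"
proof -
  obtain a b c where T: "T = {a, b, c}" "a \<noteq> b" "a \<noteq> c" "b \<noteq> c"
    using assms by (auto simp: card_3_iff)
  have "x \<in> T \<and> y \<in> T \<and> z \<in> T \<and> x \<noteq> y \<and> x \<noteq> z \<and> y \<noteq> z" if "{x, y, z} = T" for x y z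
  proof -
    have "card {x, y, z} = 3" using assms that by simp
    then have "x \<noteq> y" "x \<noteq> z" "y \<noteq> z" by (auto simp: card_insert_if split: if_splits)
    then show ?thesis using that by blast
  qed
  then have "{(x, y, z). {x, y, z} = T} \<subseteq>
      {(x, y, z) \<in> {a, b, c} \<times> {a, b, c} \<times> {a, b, c}. x \<noteq> y \<and> x \<noteq> z \<and> y \<noteq> z}"
    unfolding T(1) by blast
  also have "\<dots> \<subseteq> {(a, b, c), (a, c, b), (b, a, c), (b, c, a), (c, a, b), (c, b, a)}"
    by auto
  finally have "{(x, y, z). {x, y, z} = T} =
      {(a, b, c), (a, c, b), (b, a, c), (b, c, a), (c, a, b), (c, b, a)}"
    unfolding T(1) by (rule equalityI) (simp add: insert_commute)
  then show ?thesis using T(2-) by simp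
qed

text \<open>Forgetting the order of three pairwise adjacent vertices is a six-to-one map onto the
  triangles.\<close>

lemma num_triangles_ordered:
  assumes "pair_graph H"
  shows "6 * int (num_triangles H) = (\<Sum>x\<in>pverts H. \<Sum>y\<in>pverts H. \<Sum>z\<in>pverts H.
    of_bool ((x, y) \<in> parcs H) * of_bool ((x, z) \<in> parcs H) * of_bool ((y, z) \<in> parcs H))"
proof -
  interpret pair_graph H by fact
  let ?V = "pverts H" and ?E = "parcs H"
  define P where "P = {(x, y, z) \<in> ?V \<times> ?V \<times> ?V. (x, y) \<in> ?E \<and> (x, z) \<in> ?E \<and> (y, z) \<in> ?E}"
  have finV: "finite ?V" by (rule pair_finite_verts)
  have finP: "finite P" using finV by (auto simp: P_def intro: finite_subset[of _ "?V \<times> ?V \<times> ?V"])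
  have finT: "finite (triangles H)" using finV by (simp add: triangles_def)
  have sym: "(x, y) \<in> ?E \<Longrightarrow> (y, x) \<in> ?E" for x y by (rule arcs_symmetric)
  have img: "(\<lambda>(x, y, z). {x, y, z}) ` P \<subseteq> triangles H"
  proof clarify
    fix x y z assume "(x, y, z) \<in> P"
    then have xyz: "x \<in> ?V" "y \<in> ?V" "z \<in> ?V" "(x, y) \<in> ?E" "(x, z) \<in> ?E" "(y, z) \<in> ?E"
      by (auto simp: P_def)
    then have "x \<noteq> y" "x \<noteq> z" "y \<noteq> z" by (auto dest: no_loops')
    then show "{x, y, z} \<in> triangles H" using xyz sym[OF xyz(4)] sym[OF xyz(5)] sym[OF xyz(6)]
      by (auto simp: triangles_def)
  qed
  have fib: "{p \<in> P. (\<lambda>(x, y, z). {x, y, z}) p = T} = {(x, y, z). {x, y, z} = T}"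
    if "T \<in> triangles H" for T
  proof -
    have "(x, y, z) \<in> P" if xyz: "{x, y, z} = T" for x y z
    proof -
      have T: "card {x, y, z} = 3" "T \<subseteq> ?V" and adj: "\<And>u v. u \<in> T \<Longrightarrow> v \<in> T \<Longrightarrow> u \<noteq> v \<Longrightarrow> (u, v) \<in> ?E"
        using \<open>T \<in> triangles H\<close> xyz by (auto simp: triangles_def)
      have "x \<in> T" "y \<in> T" "z \<in> T" using xyz by auto
      moreover have "x \<noteq> y" "x \<noteq> z" "y \<noteq> z"
        using T(1) by (auto simp: card_insert_if split: if_splits)
      ultimately show ?thesis using T(2) adj by (auto simp: P_def)
    qed
    then show ?thesis by auto
  qed
  have "int (card P) = (\<Sum>T\<in>triangles H. \<Sum>p | p \<in> P \<and> (\<lambda>(x, y, z). {x, y, z}) p = T. 1)"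
    using sum.group[OF finP finT img, of "\<lambda>_. 1 :: int"] by simp
  also have "\<dots> = (\<Sum>T\<in>triangles H. 6)"
  proof (rule sum.cong[OF refl])
    fix T assume "T \<in> triangles H"
    then show "(\<Sum>p | p \<in> P \<and> (\<lambda>(x, y, z). {x, y, z}) p = T. 1) = (6 :: int)"
      using card_3_orderings[of T] by (simp add: fib) (simp add: triangles_def)
  qed
  finally have "6 * int (num_triangles H) = int (card P)" by (simp add: num_triangles_def)
  also have "\<dots> = (\<Sum>(x, y, z)\<in>?V \<times> ?V \<times> ?V. of_bool ((x, y) \<in> ?E \<and> (x, z) \<in> ?E \<and> (y, z) \<in> ?E))"
  proof -
    have "P = (?V \<times> ?V \<times> ?V) \<inter> {(x, y, z). (x, y) \<in> ?E \<and> (x, z) \<in> ?E \<and> (y, z) \<in> ?E}"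
      by (auto simp: P_def)
    then show ?thesis using finV by (simp add: case_prod_unfold)
  qed
  also have "\<dots> = (\<Sum>x\<in>?V. \<Sum>y\<in>?V. \<Sum>z\<in>?V. of_bool ((x, y) \<in> ?E \<and> (x, z) \<in> ?E \<and> (y, z) \<in> ?E))"
    by (simp add: sum.cartesian_product del: sum_of_bool_eq)
  finally show ?thesis by (simp add: of_bool_conj mult.assoc)
qed

section \<open>Isomorphisms of pair digraphs\<close>

text \<open>A digraph isomorphism also carries an arc map and new head and tail functions; for pair
  digraphs the vertex map \<open>f\<close> determines a suitable choice.\<close>

lemma digraph_iso_with_projI:
  assumes "pair_wf_digraph H" "pair_wf_digraph K"
    and "bij_betw f (pverts H) (pverts K)"
    and adj: "\<And>u v. u \<in> pverts H \<Longrightarrow> v \<in> pverts H \<Longrightarrow> (u, v) \<in> parcs H \<longleftrightarrow> (f u, f v) \<in> parcs K"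
  shows "digraph_iso (with_proj H) (with_proj K)"
proof -
  interpret H: pair_wf_digraph H by fact
  interpret K: pair_wf_digraph K by fact
  let ?h = "\<lparr>iso_verts = f, iso_arcs = map_prod f f, iso_head = snd, iso_tail = fst\<rparr>"
  have inj: "inj_on f (pverts H)" and img: "f ` pverts H = pverts K"
    using assms(3) by (auto simp: bij_betw_def)
  have "inj_on (map_prod f f) (parcs H)"
    using map_prod_inj_on[OF inj inj] by (rule inj_on_subset) (auto dest: H.in_arcsD1 H.in_arcsD2)
  then have "pre_digraph.digraph_isomorphism (with_proj H) ?h"
    using inj H.wf_digraph_axioms by (simp add: pre_digraph.digraph_isomorphism_def)
  moreover have "parcs K = map_prod f f ` parcs H"
  proof (intro equalityI subsetI)
    fix a assume a: "a \<in> parcs K"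
    then have "fst a \<in> f ` pverts H" "snd a \<in> f ` pverts H"
      using img K.arc_fst_in_verts K.arc_snd_in_verts by auto
    then obtain u v where uv: "fst a = f u" "snd a = f v" "u \<in> pverts H" "v \<in> pverts H" by auto
    then have "a = map_prod f f (u, v)" by (simp add: prod_eq_iff)
    moreover have "(u, v) \<in> parcs H" using a adj uv by (metis prod.collapse)
    ultimately show "a \<in> map_prod f f ` parcs H" by (rule image_eqI)
  next
    fix a assume "a \<in> map_prod f f ` parcs H"
    then obtain u v where "(u, v) \<in> parcs H" "a = (f u, f v)" by auto
    then show "a \<in> parcs K" using adj[of u v] H.in_arcsD1 H.in_arcsD2 by simp
  qed
  then have "with_proj K = app_iso ?h (with_proj H)"
    using img by (simp add: with_proj_def app_iso_def)
  ultimately show ?thesis unfolding digraph_iso_def by blast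
qed

text \<open>The head and tail functions of the target are \<open>snd\<close> and \<open>fst\<close>,
  which forces the arc map to act as the vertex map on both ends.\<close>

lemma digraph_iso_with_projE:
  assumes "digraph_iso (with_proj H) (with_proj K)"
  obtains f where "bij_betw f (pverts H) (pverts K)" "parcs K = map_prod f f ` parcs H"
    "parcs H \<subseteq> pverts H \<times> pverts H"
proof -
  obtain h where h: "pre_digraph.digraph_isomorphism (with_proj H) h" "with_proj K = app_iso h (with_proj H)"
    using assms by (auto simp: digraph_iso_def)
  note d = h(1)[unfolded pre_digraph.digraph_isomorphism_def, simplified]
  have K: "pverts K = iso_verts h ` pverts H" "parcs K = iso_arcs h ` parcs H" "iso_tail h = fst" "iso_head h = snd"
    using h(2) by (auto simp: with_proj_def app_iso_def)
  have "iso_arcs h a = map_prod (iso_verts h) (iso_verts h) a" if "a \<in> parcs H" for a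
    using d that K(3,4) by (auto intro: prod_eqI)
  then have "parcs K = map_prod (iso_verts h) (iso_verts h) ` parcs H"
    unfolding K(2) by (intro image_cong) auto
  moreover have "bij_betw (iso_verts h) (pverts H) (pverts K)"
    using d K by (simp add: bij_betw_def)
  moreover have "parcs H \<subseteq> pverts H \<times> pverts H"
    using d by (auto simp: wf_digraph_wp_iff dest: pair_wf_digraph.in_arcsD1 pair_wf_digraph.in_arcsD2)
  ultimately show thesis using that by blast
qed

lemma num_triangles_iso:
  assumes "digraph_iso (with_proj H) (with_proj K)"
  shows "num_triangles H = num_triangles K"
proof -
  obtain f where f: "bij_betw f (pverts H) (pverts K)" and E: "parcs K = map_prod f f ` parcs H"
    and wf: "parcs H \<subseteq> pverts H \<times> pverts H"
    using digraph_iso_with_projE[OF assms] .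
  have inj: "inj_on f (pverts H)" and img: "f ` pverts H = pverts K"
    using f by (auto simp: bij_betw_def)
  have adj: "(f u, f v) \<in> parcs K \<longleftrightarrow> (u, v) \<in> parcs H" if "u \<in> pverts H" "v \<in> pverts H" for u v
  proof
    assume "(f u, f v) \<in> parcs K"
    then obtain u' v' where uv': "(u', v') \<in> parcs H" "f u = f u'" "f v = f v'" unfolding E by auto
    then have "u' \<in> pverts H" "v' \<in> pverts H" using wf by auto
    then show "(u, v) \<in> parcs H" using uv' inj_onD[OF inj] that by metis
  qed (auto simp: E)
  have tri: "f ` T \<in> triangles K \<longleftrightarrow> T \<in> triangles H" if "T \<subseteq> pverts H" for T
  proof -
    have i: "inj_on f T" using inj that by (rule inj_on_subset)
    have "f ` T \<subseteq> pverts K" using that img by auto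
    moreover have "(\<forall>u\<in>f ` T. \<forall>v\<in>f ` T. u \<noteq> v \<longrightarrow> (u, v) \<in> parcs K) \<longleftrightarrow>
        (\<forall>u\<in>T. \<forall>v\<in>T. u \<noteq> v \<longrightarrow> (u, v) \<in> parcs H)"
      using adj that inj_on_eq_iff[OF i] by (simp add: subset_iff)
    ultimately show ?thesis using that i by (simp add: triangles_def card_image)
  qed
  have "bij_betw ((`) f) (triangles H) (triangles K)"
  proof (rule bij_betw_imageI)
    show "inj_on ((`) f) (triangles H)"
      using inj by (rule inj_on_subset[OF inj_on_image_Pow]) (auto simp: triangles_def)
    show "(`) f ` triangles H = triangles K"
    proof (intro equalityI subsetI)
      fix T assume T: "T \<in> triangles K"
      then have "T \<subseteq> f ` pverts H" using img by (auto simp: triangles_def)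
      then obtain S where "S \<subseteq> pverts H" "T = f ` S" by (meson subset_imageE)
      then show "T \<in> (`) f ` triangles H" using T tri by blast
    next
      fix T assume "T \<in> (`) f ` triangles H"
      then obtain S where S: "S \<in> triangles H" "T = f ` S" by auto
      then have "S \<subseteq> pverts H" by (auto simp: triangles_def)
      then show "T \<in> triangles K" using tri S by simp
    qed
  qed
  then show ?thesis by (simp add: num_triangles_def bij_betw_same_card)
qed

section \<open>The graph \<open>H\<^sub>k\<close>\<close>

text \<open>Closed form of adjacency in \<open>Hk (2 * m + 2)\<close>. The bound
  \<open>m + 1\<close> between \<open>Zv\<close> and \<open>Yv i\<close> reflects the deleted edge;
  the last equation covers \<open>Zv\<close> with itself and the vertices \<open>Sv i\<close>, which
  lie outside \<open>hk_verts m\<close>.\<close>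

fun hk_adj :: "nat \<Rightarrow> hk_vertex \<Rightarrow> hk_vertex \<Rightarrow> bool" where
  "hk_adj m (Xv i) (Xv j) = (i \<noteq> j)"
| "hk_adj m (Yv i) (Yv j) = (i \<noteq> j)"
| "hk_adj m (Xv i) (Yv j) = (i = j \<and> i \<le> m)"
| "hk_adj m (Yv i) (Xv j) = (i = j \<and> i \<le> m)"
| "hk_adj m Zv (Xv i) = (i > m)"
| "hk_adj m (Xv i) Zv = (i > m)"
| "hk_adj m Zv (Yv i) = (i > m + 1)"
| "hk_adj m (Yv i) Zv = (i > m + 1)"
| "hk_adj m _ _ = False"

abbreviation hk_verts :: "nat \<Rightarrow> hk_vertex set" where
  "hk_verts m \<equiv> insert Zv (Xv ` {1..2 * m + 1} \<union> Yv ` {1..2 * m + 1})"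

text \<open>The invariant of the repeated subdivision, with \<open>j\<close> general for the
  induction on the number of steps.\<close>

lemma fold_subdivide:
  fixes A B :: "nat set"
  defines "G j \<equiv> fold (\<lambda>i G. subdivide G (Xv i, Yv i) (Sv i)) [1..<Suc j] (complete_bipartite (Xv ` A) (Yv ` B))"
  shows "pverts (G j) = Xv ` A \<union> Yv ` B \<union> Sv ` {1..j}"
    and "parcs (G j) = {(Xv a, Yv b) | a b. a \<in> A \<and> b \<in> B \<and> \<not> (a = b \<and> 1 \<le> a \<and> a \<le> j)}
      \<union> {(Yv b, Xv a) | b a. a \<in> A \<and> b \<in> B \<and> \<not> (a = b \<and> 1 \<le> a \<and> a \<le> j)}
      \<union> (\<Union>i\<in>{1..j}. {(Xv i, Sv i), (Sv i, Xv i), (Sv i, Yv i), (Yv i, Sv i)})"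
proof (induction j)
  case 0
  { case 1 show ?case by (simp add: G_def complete_bipartite_def) }
  { case 2 show ?case by (auto simp: G_def complete_bipartite_def) }
next
  case (Suc j)
  have G: "G (Suc j) = subdivide (G j) (Xv (Suc j), Yv (Suc j)) (Sv (Suc j))"
    by (simp add: G_def)
  { case 1 show ?case unfolding G using Suc(1) by (auto simp: atLeastAtMostSuc_conv) }
  { case 2 show ?case unfolding G arcs_subdivide Suc(2) by (auto simp: atLeastAtMostSuc_conv le_Suc_eq) }
qed

lemma Hk_eq:
  assumes "m \<ge> 1"
  shows "pverts (Hk (2 * m + 2)) = hk_verts m"
    and "parcs (Hk (2 * m + 2)) = {(u, v). u \<in> hk_verts m \<and> v \<in> hk_verts m \<and> hk_adj m u v}"
proof -
  let ?k = "2 * m + 2" and ?I = "{1..2 * m + 1}"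
  have k: "?k div 2 = Suc m" "?k - 1 = 2 * m + 1" by auto
  note sd = fold_subdivide[of m ?I ?I]
  define f where "f v = (if v \<in> Sv ` {1..m} then Zv else v)" for v
  have f: "f (Xv i) = Xv i" "f (Yv i) = Yv i" "i \<in> {1..m} \<Longrightarrow> f (Sv i) = Zv" for i
    by (auto simp: f_def)
  have Hk': "Hk' ?k = \<lparr>pverts = f ` pverts (subdivided_bipartite ?k), parcs = map_prod f f ` parcs (subdivided_bipartite ?k)\<rparr>"
    by (simp add: Hk'_def identify_verts_def Let_def f_def[abs_def])
  \<comment> \<open>As \<open>m \<ge> 1\<close>, there is at least one subdivision vertex, so
    \<open>Zv\<close> does occur.\<close>
  have S: "f ` Sv ` {1..m} = {Zv}"
    using assms by (simp add: image_image f image_constant_conv cong: image_cong_simp)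
  have v: "pverts (Hk' ?k) = hk_verts m"
    unfolding Hk' subdivided_bipartite_def k using sd(1) S by (simp add: image_Un image_image f)
  have img: "map_prod f f ` {(g a, h b) | a b. P a b} = {(f (g a), f (h b)) | a b. P a b}"
    for g h :: "nat \<Rightarrow> hk_vertex" and P
    by force
  have "map_prod f f ` (\<Union>i\<in>{1..m}. {(Xv i, Sv i), (Sv i, Xv i), (Sv i, Yv i), (Yv i, Sv i)})
      = (\<Union>i\<in>{1..m}. {(Xv i, Zv), (Zv, Xv i), (Zv, Yv i), (Yv i, Zv)})"
    unfolding image_UN by (rule SUP_cong[OF refl]) (simp add: f)
  then have a: "parcs (Hk' ?k) = {(Xv a, Yv b) | a b. a \<in> ?I \<and> b \<in> ?I \<and> \<not> (a = b \<and> 1 \<le> a \<and> a \<le> m)}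
      \<union> {(Yv b, Xv a) | b a. a \<in> ?I \<and> b \<in> ?I \<and> \<not> (a = b \<and> 1 \<le> a \<and> a \<le> m)}
      \<union> (\<Union>i\<in>{1..m}. {(Xv i, Zv), (Zv, Xv i), (Zv, Yv i), (Yv i, Zv)})"
    unfolding Hk' subdivided_bipartite_def k
    by (simp only: pair_pre_digraph.simps sd(2) image_Un img f(1,2))
  show "pverts (Hk ?k) = hk_verts m"
    using v by (simp add: Hk_def delete_edge_def complement_graph_def)
  show "parcs (Hk ?k) = {(u, v). u \<in> hk_verts m \<and> v \<in> hk_verts m \<and> hk_adj m u v}"
  proof (intro set_eqI iffI; clarify)
    fix u v
    assume "(u, v) \<in> parcs (Hk ?k)"
    then have "u \<in> hk_verts m" "v \<in> hk_verts m" "u \<noteq> v" "(u, v) \<notin> parcs (Hk' ?k)"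
      "(u, v) \<noteq> (Zv, Yv (m + 1))" "(u, v) \<noteq> (Yv (m + 1), Zv)"
      unfolding Hk_def delete_edge_def complement_graph_def pair_pre_digraph.simps v k by simp_all
    then show "u \<in> hk_verts m \<and> v \<in> hk_verts m \<and> hk_adj m u v"
      unfolding a by (cases u; cases v) auto
  next
    fix u v
    assume uv: "u \<in> hk_verts m" "v \<in> hk_verts m" "hk_adj m u v"
    then have "(u, v) \<notin> parcs (Hk' ?k)" "u \<noteq> v" "(u, v) \<noteq> (Zv, Yv (m + 1))" "(u, v) \<noteq> (Yv (m + 1), Zv)"
      unfolding a by (cases u; cases v; auto)+
    then show "(u, v) \<in> parcs (Hk ?k)"
      using uv unfolding Hk_def delete_edge_def complement_graph_def pair_pre_digraph.simps v k by simp
  qed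
qed

lemma pair_wf_digraph_Hk: "m \<ge> 1 \<Longrightarrow> pair_wf_digraph (Hk (2 * m + 2))"
  by unfold_locales (simp_all only: Hk_eq, auto)

text \<open>An edge from \<open>Xv i\<close> to \<open>Yv i\<close> lies in no triangle: such edges
  form a matching between two cliques, and \<open>Zv\<close> is not adjacent to \<open>Xv i\<close>
  for \<open>i \<le> m\<close>. So every triangle stays within one clique and
  \<open>Zv\<close>.\<close>

lemma triangles_Hk:
  assumes "m \<ge> 1"
  shows "triangles (Hk (2 * m + 2)) =
     {T. T \<subseteq> Xv ` {1..2 * m + 1} \<and> card T = 3} \<union> {T. T \<subseteq> Yv ` {1..2 * m + 1} \<and> card T = 3}
     \<union> insert Zv ` {T. T \<subseteq> Xv ` {m + 1..2 * m + 1} \<and> card T = 2}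
     \<union> insert Zv ` {T. T \<subseteq> Yv ` {m + 2..2 * m + 1} \<and> card T = 2}" (is "?L = ?A \<union> ?B \<union> ?C \<union> ?D")
proof (intro equalityI subsetI)
  fix T assume "T \<in> ?L"
  then have T: "T \<subseteq> hk_verts m" "card T = 3"
    and adj: "\<And>u v. u \<in> T \<Longrightarrow> v \<in> T \<Longrightarrow> u \<noteq> v \<Longrightarrow> hk_adj m u v"
    unfolding triangles_def Hk_eq[OF assms] by auto
  have mix: "\<not> (Xv i \<in> T \<and> Yv j \<in> T)" for i j
  proof
    assume ij: "Xv i \<in> T \<and> Yv j \<in> T"
    then have eq: "i = j" "j \<le> m" using adj[of "Xv i" "Yv j"] by auto
    have "\<not> T \<subseteq> {Xv i, Yv j}" using T(2) card_mono[of "{Xv i, Yv j}" T] by auto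
    then obtain t where t: "t \<in> T" "t \<noteq> Xv i" "t \<noteq> Yv j" by auto
    then show False
      using eq ij adj[of t "Xv i"] adj[of t "Yv j"] by (cases t) auto
  qed
  have fin: "finite T" using T(2) by (intro card_ge_0_finite) simp
  let ?T = "T - {Zv}"
  have sub: "?T \<subseteq> Xv ` {1..2 * m + 1} \<or> ?T \<subseteq> Yv ` {1..2 * m + 1}"
  proof (rule ccontr)
    assume "\<not> ?thesis"
    then obtain u v where "u \<in> ?T" "u \<notin> Xv ` {1..2 * m + 1}" "v \<in> ?T" "v \<notin> Yv ` {1..2 * m + 1}" by auto
    then show False using T(1) mix by blast
  qed
  show "T \<in> ?A \<union> ?B \<union> ?C \<union> ?D"
  proof (cases "Zv \<in> T")
    case True
    have c: "card ?T = 2" "T = insert Zv ?T" using True T(2) fin by auto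
    from sub show ?thesis
    proof
      assume "?T \<subseteq> Xv ` {1..2 * m + 1}"
      then have "?T \<subseteq> Xv ` {m + 1..2 * m + 1}"
        using adj[OF True] by fastforce
      then have "T \<in> ?C" using c by blast
      then show ?thesis by blast
    next
      assume "?T \<subseteq> Yv ` {1..2 * m + 1}"
      then have "?T \<subseteq> Yv ` {m + 2..2 * m + 1}"
        using adj[OF True] by fastforce
      then have "T \<in> ?D" using c by blast
      then show ?thesis by blast
    qed
  next
    case False
    then show ?thesis using sub T(2) by auto
  qed
next
  fix T assume T: "T \<in> ?A \<union> ?B \<union> ?C \<union> ?D"
  moreover have "card (insert Zv S) = 3" if "S \<subseteq> Xv ` I \<or> S \<subseteq> Yv ` I" "card S = 2" for S I
  proof -
    have "finite S" using that(2) by (intro card_ge_0_finite) simp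
    then show ?thesis using that by (subst card_insert_disjoint) auto
  qed
  ultimately have T3: "card T = 3" by blast
  \<comment> \<open>\<open>S\<close> is a set of pairwise adjacent labels and may be infinite; the
    upper index bound is left to \<open>hk_verts m\<close>.\<close>
  have clique: "T \<in> ?L" if T: "\<And>u. u \<in> T \<Longrightarrow> u \<in> S \<and> u \<in> hk_verts m"
    and S: "\<And>u v. u \<in> S \<Longrightarrow> v \<in> S \<Longrightarrow> u \<noteq> v \<Longrightarrow> hk_adj m u v" for S
  proof -
    have "T \<subseteq> hk_verts m" "\<forall>u\<in>T. \<forall>v\<in>T. u \<noteq> v \<longrightarrow> u \<in> hk_verts m \<and> v \<in> hk_verts m \<and> hk_adj m u v"
      using T S by blast+
    then show ?thesis using T3 unfolding triangles_def Hk_eq[OF assms] mem_Collect_eq prod.case by blast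
  qed
  have adj: "hk_adj m u v" if "u \<in> S" "v \<in> S" "u \<noteq> v"
    "S = Xv ` UNIV \<or> S = Yv ` UNIV \<or> S = insert Zv (Xv ` {m + 1..}) \<or> S = insert Zv (Yv ` {m + 2..})" for u v S
    using that by auto
  from T show "T \<in> ?L"
  proof (elim UnE)
    assume "T \<in> ?A"
    then show ?thesis by (intro clique[of "Xv ` UNIV"] adj) auto
  next
    assume "T \<in> ?B"
    then show ?thesis by (intro clique[of "Yv ` UNIV"] adj) auto
  next
    assume "T \<in> ?C"
    then obtain S where "T = insert Zv S" "S \<subseteq> Xv ` {m + 1..2 * m + 1}" by blast
    moreover have "Xv ` {m + 1..2 * m + 1} \<subseteq> Xv ` {m + 1..} \<inter> Xv ` {1..2 * m + 1}" by auto
    ultimately show ?thesis by (intro clique[of "insert Zv (Xv ` {m + 1..})"] adj) blast+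
  next
    assume "T \<in> ?D"
    then obtain S where "T = insert Zv S" "S \<subseteq> Yv ` {m + 2..2 * m + 1}" by blast
    moreover have "Yv ` {m + 2..2 * m + 1} \<subseteq> Yv ` {m + 2..} \<inter> Yv ` {1..2 * m + 1}" by auto
    ultimately show ?thesis by (intro clique[of "insert Zv (Yv ` {m + 2..})"] adj) blast+
  qed
qed

text \<open>\<open>Zv\<close> has \<open>m + 1\<close> neighbours in one clique and \<open>m\<close>
  in the other, and \<open>(m + 1) choose 2\<close> plus \<open>m choose 2\<close> is
  \<open>m\<^sup>2\<close>.\<close>

lemma num_triangles_Hk:
  assumes "m \<ge> 1"
  shows "num_triangles (Hk (2 * m + 2)) = 2 * ((2 * m + 1) choose 3) + m\<^sup>2"
proof -
  define A where "A = {T. T \<subseteq> Xv ` {1..2 * m + 1} \<and> card T = 3}"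
  define B where "B = {T. T \<subseteq> Yv ` {1..2 * m + 1} \<and> card T = 3}"
  define C where "C = {T. T \<subseteq> Xv ` {m + 1..2 * m + 1} \<and> card T = 2}"
  define D where "D = {T. T \<subseteq> Yv ` {m + 2..2 * m + 1} \<and> card T = 2}"
  have fin: "finite A" "finite B" "finite C" "finite D" by (auto simp: A_def B_def C_def D_def)
  have cX: "card (Xv ` I) = card I" and cY: "card (Yv ` I) = card I" for I
    by (auto intro!: card_image inj_onI)
  have n: "card A = (2 * m + 1) choose 3" "card B = (2 * m + 1) choose 3"
    "card C = (m + 1) choose 2" "card D = m choose 2"
    unfolding A_def B_def C_def D_def by (subst n_subsets; simp add: cX cY)+
  have noZ: "Zv \<notin> T" if "T \<in> A \<union> B \<union> C \<union> D" for T
    using that by (auto simp: A_def B_def C_def D_def)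
  have inj: "inj_on (insert Zv) (C \<union> D)"
    using noZ by (intro inj_onI) (metis UnI1 UnI2 Un_assoc insert_ident)
  have card: "card (insert Zv ` C) = card C" "card (insert Zv ` D) = card D"
    using inj by (auto intro!: card_image intro: inj_on_subset)
  have XY: "S = {}" if "S \<subseteq> Xv ` I" "S \<subseteq> Yv ` J" for S I J
    using that by fastforce
  have "A \<inter> B = {}"
  proof (rule equals0I)
    fix T assume "T \<in> A \<inter> B"
    then have "T \<subseteq> range Xv" "T \<subseteq> range Yv" "card T = 3" by (auto simp: A_def B_def)
    from XY[OF this(1,2)] this(3) show False by simp
  qed
  moreover have "C \<inter> D = {}"
  proof (rule equals0I)
    fix T assume "T \<in> C \<inter> D"
    then have "T \<subseteq> range Xv" "T \<subseteq> range Yv" "card T = 2" by (auto simp: C_def D_def)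
    from XY[OF this(1,2)] this(3) show False by simp
  qed
  then have "insert Zv ` C \<inter> insert Zv ` D = {}" using inj_on_image_Int[OF inj, of C D] by simp
  moreover have "(A \<union> B) \<inter> insert Zv ` (C \<union> D) = {}" using noZ by blast
  ultimately have "A \<inter> B = {}" "(A \<union> B) \<inter> insert Zv ` C = {}" "(A \<union> B \<union> insert Zv ` C) \<inter> insert Zv ` D = {}"
    by (simp_all add: image_Un Int_Un_distrib Int_Un_distrib2)
  then have "num_triangles (Hk (2 * m + 2)) = card A + card B + card C + card D"
    using fin unfolding num_triangles_def triangles_Hk[OF assms] A_def[symmetric] B_def[symmetric] C_def[symmetric] D_def[symmetric]
    by (simp add: card_Un_disjoint card)
  moreover have "((m + 1) choose 2) + (m choose 2) = m\<^sup>2"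
    by (induction m) (auto simp: numeral_2_eq_2)
  ultimately show ?thesis by (simp add: n)
qed

section \<open>Recognising the extremal graph\<close>

lemma Hk_iso:
  assumes H: "pair_graph H" and m: "m \<ge> 1"
    and x: "inj_on x {1..2 * m + 1}" and y: "inj_on y {1..2 * m + 1}"
    and V: "pverts H = insert c (x ` {1..2 * m + 1} \<union> y ` {1..2 * m + 1})"
    and c: "c \<notin> x ` {1..2 * m + 1}" "c \<notin> y ` {1..2 * m + 1}"
    and xy: "x ` {1..2 * m + 1} \<inter> y ` {1..2 * m + 1} = {}"
    and xx_adj: "\<And>i j. i \<in> {1..2 * m + 1} \<Longrightarrow> j \<in> {1..2 * m + 1} \<Longrightarrow> (x i, x j) \<in> parcs H \<longleftrightarrow> i \<noteq> j"
    and yy_adj: "\<And>i j. i \<in> {1..2 * m + 1} \<Longrightarrow> j \<in> {1..2 * m + 1} \<Longrightarrow> (y i, y j) \<in> parcs H \<longleftrightarrow> i \<noteq> j"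
    and cx_adj: "\<And>i. i \<in> {1..2 * m + 1} \<Longrightarrow> (c, x i) \<in> parcs H \<longleftrightarrow> i > m"
    and cy_adj: "\<And>i. i \<in> {1..2 * m + 1} \<Longrightarrow> (c, y i) \<in> parcs H \<longleftrightarrow> i > m + 1"
    and xy_adj: "\<And>i j. i \<in> {1..2 * m + 1} \<Longrightarrow> j \<in> {1..2 * m + 1} \<Longrightarrow> (x i, y j) \<in> parcs H \<longleftrightarrow> i = j \<and> i \<le> m"
  shows "digraph_iso (with_proj H) (with_proj (Hk (2 * m + 2)))"
proof -
  interpret pair_graph H by fact
  let ?I = "{1..2 * m + 1}"
  \<comment> \<open>The map goes from \<open>Hk\<close> to \<open>H\<close>, where the labels define
    it directly; the default \<open>c\<close> is meant for \<open>Zv\<close>, as no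
    \<open>Sv i\<close> is a vertex of \<open>Hk\<close>.\<close>
  define g where "g v = (case v of Xv i \<Rightarrow> x i | Yv i \<Rightarrow> y i | _ \<Rightarrow> c)" for v
  have g: "g (Xv i) = x i" "g (Yv i) = y i" "g Zv = c" for i by (auto simp: g_def)
  have sym: "(u, v) \<in> parcs H \<longleftrightarrow> (v, u) \<in> parcs H" for u v using arcs_symmetric by blast
  have xc_adj: "(x i, c) \<in> parcs H \<longleftrightarrow> i > m" and yc_adj: "(y i, c) \<in> parcs H \<longleftrightarrow> i > m + 1" if "i \<in> ?I" for i
    using sym[of c "x i"] sym[of c "y i"] cx_adj[OF that] cy_adj[OF that] by auto
  have yx_adj: "(y i, x j) \<in> parcs H \<longleftrightarrow> i = j \<and> i \<le> m" if "i \<in> ?I" "j \<in> ?I" for i j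
    using sym[of "y i" "x j"] xy_adj[OF that(2,1)] by auto
  have "inj_on g (hk_verts m)"
  proof (rule inj_onI)
    fix u v assume uv: "u \<in> hk_verts m" "v \<in> hk_verts m" "g u = g v"
    have "x i \<noteq> y j" "y j \<noteq> x i" "x i \<noteq> c" "y j \<noteq> c" "c \<noteq> x i" "c \<noteq> y j" if "i \<in> ?I" "j \<in> ?I" for i j using xy c that by blast+
    then show "u = v"
      using uv inj_on_eq_iff[OF x] inj_on_eq_iff[OF y] c by (cases u; cases v) (auto simp: g)
  qed
  moreover have "g ` hk_verts m = pverts H"
    by (simp add: V image_Un image_image g)
  ultimately have "bij_betw g (pverts (Hk (2 * m + 2))) (pverts H)"
    by (simp only: bij_betw_def Hk_eq[OF m])
  moreover have "(u, v) \<in> parcs (Hk (2 * m + 2)) \<longleftrightarrow> (g u, g v) \<in> parcs H"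
    if "u \<in> pverts (Hk (2 * m + 2))" "v \<in> pverts (Hk (2 * m + 2))" for u v
  proof -
    have uv: "u \<in> hk_verts m" "v \<in> hk_verts m" using that by (simp_all only: Hk_eq[OF m])
    have ir: "(c, c) \<notin> parcs H" using no_loops' by blast
    have "hk_adj m u v \<longleftrightarrow> (g u, g v) \<in> parcs H"
      using uv by (cases u; cases v)
        (auto simp: g ir xx_adj yy_adj cx_adj cy_adj xy_adj xc_adj yc_adj yx_adj)
    then show ?thesis using uv by (simp only: Hk_eq[OF m] mem_Collect_eq prod.case simp_thms)
  qed
  ultimately have "digraph_iso (with_proj (Hk (2 * m + 2))) (with_proj H)"
    using pair_wf_digraph_Hk[OF m] by (intro digraph_iso_with_projI[of _ _ g]) auto
  then show ?thesis
    using digraph_iso_swap pair_wf_digraph_Hk[OF m] wf_digraph_wp_iff by blast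
qed

section \<open>Passage to the complement\<close>

text \<open>For these degrees \<open>goodman\<close> yields the stated constant, so
  \<open>tri \<ge> 6 * (int m)\<^sup>2\<close> in the complement is exactly the bound on the
  triangles of \<open>H\<close>.\<close>

lemma near_regular_complement:
  assumes "pair_graph H" "m \<ge> 1" "card (pverts H) = 4 * m + 3" "w \<in> pverts H"
    and "out_degree (with_proj H) w = 2 * m"
    and "\<And>v. v \<in> pverts H \<Longrightarrow> v \<noteq> w \<Longrightarrow> out_degree (with_proj H) v = 2 * m + 1"
  defines "adj \<equiv> \<lambda>u v. u \<noteq> v \<and> (u, v) \<notin> parcs H"
  shows "near_regular adj (pverts H) w m"
    and "6 * int (num_triangles H) + sym_rel.tri adj (pverts H)
       = 12 * int ((2 * m + 1) choose 3) + 12 * (int m)\<^sup>2"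
proof -
  interpret pair_graph H by fact
  interpret sym_rel adj
    using arcs_symmetric by unfold_locales (auto simp: adj_def)
  let ?V = "pverts H"
  have fin: "finite ?V" by (rule pair_finite_verts)
  have dg: "dg ?V v = 4 * int m + 2 - int (out_degree (with_proj H) v)" if "v \<in> ?V" for v
  proof -
    have "out_arcs (with_proj H) v = Pair v ` {y \<in> ?V. (v, y) \<in> parcs H}"
      using in_arcsD2 by (auto simp: out_arcs_def)
    then have "out_degree (with_proj H) v = card {y \<in> ?V. (v, y) \<in> parcs H}"
      unfolding out_degree_def by (simp add: card_image inj_on_def)
    \<comment> \<open>\<open>adj\<close> is irreflexive, so \<open>v\<close> is among its own
      non-neighbours and has to be removed.\<close>
    also have "{y \<in> ?V. (v, y) \<in> parcs H} = {y \<in> ?V. \<not> adj v y} - {v}"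
      using no_loops' by (auto simp: adj_def)
    also have "int (card \<dots>) = int (card {y \<in> ?V. \<not> adj v y}) - 1"
    proof -
      have "v \<in> {y \<in> ?V. \<not> adj v y}" using that by (simp add: adj_def)
      moreover from this have "card {y \<in> ?V. \<not> adj v y} > 0" using fin by (auto simp: card_gt_0_iff)
      ultimately show ?thesis using fin by (simp add: of_nat_diff)
    qed
    finally show ?thesis using card_non_nbrs[OF fin, of v] assms(3) by simp
  qed
  show nr: "near_regular adj ?V w m"
    using fin assms(2-4) dg assms(5,6) by unfold_locales auto
  have n: "int (card ?V) - 1 = 4 * int m + 2" using assms(3) by simp
  have "(\<Sum>x\<in>?V. dg ?V x * (int (card ?V) - 1 - dg ?V x)) =
      dg ?V w * (4 * int m + 2 - dg ?V w) + (\<Sum>x\<in>?V - {w}. dg ?V x * (4 * int m + 2 - dg ?V x))"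
    unfolding n using fin assms(4) by (rule sum.remove)
  also have "(\<Sum>x\<in>?V - {w}. dg ?V x * (4 * int m + 2 - dg ?V x)) =
      (\<Sum>x\<in>?V - {w}. (2 * int m + 1) * (2 * int m + 1))"
  proof (rule sum.cong[OF refl])
    fix x assume "x \<in> ?V - {w}"
    then have "dg ?V x = 2 * int m + 1" using dg assms(6) by simp
    then show "dg ?V x * (4 * int m + 2 - dg ?V x) = (2 * int m + 1) * (2 * int m + 1)" by simp
  qed
  also have "dg ?V w = 2 * int m + 2" using dg[OF assms(4)] assms(5) by simp
  finally have S: "(\<Sum>x\<in>?V. dg ?V x * (int (card ?V) - 1 - dg ?V x)) =
      (2 * int m + 2) * (2 * int m) + (4 * int m + 2) * ((2 * int m + 1) * (2 * int m + 1))"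
    using fin assms(3,4) by (simp add: algebra_simps)
  have "(of_bool (x \<noteq> y \<and> \<not> adj x y) :: int) = of_bool ((x, y) \<in> parcs H)" for x y
    using no_loops' by (auto simp: adj_def)
  then have "tri ?V + 6 * int (num_triangles H) = int (card ?V) * (int (card ?V) - 1) * (int (card ?V) - 2)
      - 3 * (\<Sum>x\<in>?V. dg ?V x * (int (card ?V) - 1 - dg ?V x))"
    using goodman[OF fin] num_triangles_ordered[OF assms(1)] by simp
  moreover have "6 * int ((2 * m + 1) choose 3) = (2 * int m + 1) * (2 * int m) * (2 * int m - 1)"
  proof -
    have "(2 * m) choose 2 = m * (2 * m - 1)"
      by (simp add: choose_two)
    then have "(2 * m + 1) * (m * (2 * m - 1)) = ((2 * m + 1) choose 3) * 3"
      using Suc_times_binomial_eq[of "2 * m" 2] by (simp add: numeral_3_eq_3)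
    then have "int ((2 * m + 1) choose 3) * 3 = int ((2 * m + 1) * (m * (2 * m - 1)))" by simp
    moreover have "int (2 * m - 1) = 2 * int m - 1" using assms(2) by simp
    ultimately have "int ((2 * m + 1) choose 3) * 3 = (2 * int m + 1) * (int m * (2 * int m - 1))"
      by (simp only: of_nat_mult of_nat_add of_nat_numeral of_nat_1)
    then show ?thesis by (simp add: algebra_simps)
  qed
  ultimately show "6 * int (num_triangles H) + tri ?V = 12 * int ((2 * m + 1) choose 3) + 12 * (int m)\<^sup>2"
    unfolding S unfolding assms(3) by (simp add: algebra_simps power2_eq_square)
qed

theorem theorem8:
  fixes k :: nat and H :: "'a pair_pre_digraph"
  assumes "even k" and "k \<ge> 4"
    and "pair_graph H"
    and "card (pverts H) = 2 * k - 1"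
    and "\<exists>w \<in> pverts H. out_degree (with_proj H) w = k - 2 \<and>
           (\<forall>v \<in> pverts H - {w}. out_degree (with_proj H) v = k - 1)"
  shows "num_triangles H \<le> 2 * ((k - 1) choose 3) + (k div 2 - 1)\<^sup>2 \<and>
    (num_triangles H = 2 * ((k - 1) choose 3) + (k div 2 - 1)\<^sup>2 \<longleftrightarrow>
       digraph_iso (with_proj H) (with_proj (Hk k)))"
proof -
  define m where "m = k div 2 - 1"
  have k: "k = 2 * m + 2" "k div 2 - 1 = m" "k - 1 = 2 * m + 1" and m: "m \<ge> 1"
    using assms(1,2) by (auto simp: m_def elim!: evenE)
  obtain w where w: "w \<in> pverts H" "out_degree (with_proj H) w = 2 * m"
    "\<And>v. v \<in> pverts H \<Longrightarrow> v \<noteq> w \<Longrightarrow> out_degree (with_proj H) v = 2 * m + 1"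
    using assms(5) unfolding k by auto
  have card: "card (pverts H) = 4 * m + 3" using assms(4) k(1) by simp
  define adj where "adj = (\<lambda>u v. u \<noteq> v \<and> (u, v) \<notin> parcs H)"
  interpret pair_graph H by fact
  interpret near_regular adj "pverts H" w m
    unfolding adj_def by (rule near_regular_complement(1)[OF assms(3) m card w])
  have eq: "6 * int (num_triangles H) + tri (pverts H) = 12 * int ((2 * m + 1) choose 3) + 12 * (int m)\<^sup>2"
    unfolding adj_def by (rule near_regular_complement(2)[OF assms(3) m card w])
  then have "int (num_triangles H) \<le> int (2 * ((2 * m + 1) choose 3) + m\<^sup>2)"
    using tri_ge by simp
  then have le: "num_triangles H \<le> 2 * ((2 * m + 1) choose 3) + m\<^sup>2" by linarith
  have iso: "digraph_iso (with_proj H) (with_proj (Hk (2 * m + 2)))"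
    if "num_triangles H = 2 * ((2 * m + 1) choose 3) + m\<^sup>2"
  proof -
    have arc: "(u, v) \<in> parcs H \<longleftrightarrow> u \<noteq> v \<and> \<not> adj u v" for u v
      using no_loops' by (auto simp: adj_def)
    \<comment> \<open>Equality for \<open>H\<close> puts the complement at the minimum of
      \<open>tri\<close>, where its structure is known.\<close>
    have "tri (pverts H) \<le> 6 * (int m)\<^sup>2" using eq that by simp
    then obtain x y c where s:
      "inj_on x {1..2 * m + 1}" "inj_on y {1..2 * m + 1}"
      "pverts H = insert c (x ` {1..2 * m + 1} \<union> y ` {1..2 * m + 1})"
      "c \<notin> x ` {1..2 * m + 1}" "c \<notin> y ` {1..2 * m + 1}"
      "x ` {1..2 * m + 1} \<inter> y ` {1..2 * m + 1} = {}"
      and a: "\<And>i j. i \<in> {1..2 * m + 1} \<Longrightarrow> j \<in> {1..2 * m + 1} \<Longrightarrow> \<not> adj (x i) (x j)"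
      "\<And>i j. i \<in> {1..2 * m + 1} \<Longrightarrow> j \<in> {1..2 * m + 1} \<Longrightarrow> \<not> adj (y i) (y j)"
      "\<And>i. i \<in> {1..2 * m + 1} \<Longrightarrow> adj c (x i) \<longleftrightarrow> i \<le> m"
      "\<And>i. i \<in> {1..2 * m + 1} \<Longrightarrow> adj c (y i) \<longleftrightarrow> i \<le> m + 1"
      "\<And>i j. i \<in> {1..2 * m + 1} \<Longrightarrow> j \<in> {1..2 * m + 1} \<Longrightarrow> adj (x i) (y j) \<longleftrightarrow> \<not> (i = j \<and> i \<le> m)"
      by (rule extremal_structure) (rule that, assumption+)
    have ne: "c \<noteq> x i" "c \<noteq> y i" "x i \<noteq> y j" if "i \<in> {1..2 * m + 1}" "j \<in> {1..2 * m + 1}" for i j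
      using s(4-6) that by blast+
    show ?thesis
      by (rule Hk_iso[OF assms(3) m s]; unfold arc)
        (use a ne s(1,2) in \<open>auto simp: inj_on_eq_iff not_le\<close>)
  qed
  moreover have "num_triangles H = 2 * ((2 * m + 1) choose 3) + m\<^sup>2"
    if "digraph_iso (with_proj H) (with_proj (Hk (2 * m + 2)))"
    using num_triangles_iso[OF that] num_triangles_Hk[OF m] by simp
  ultimately show ?thesis
    unfolding k(2,3) using le unfolding k(1) by blast
qed

end
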